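(* There is no Pythagorean formally real field $F$ whose W-group $\mathcal G_F$ is the group (in the category $\mathcal C$) generated by five involutions $\sigma_1,\dots,\sigma_5$ subject to the relations $\sigma_i^2=1$ ($i=1,\dots,5$) and $(\sigma_1\sigma_2\sigma_3\sigma_4\sigma_5)^2=1$, with $\sigma_1,\dots,\sigma_5$ independent modulo $\Phi_F$.
   Context: All fields have characteristic $0$; Pythagorean: every sum of two squares is a square; formally real: $-1$ is not a sum of squares. $F^{(2)}=F(\sqrt a:a\in\dot F)$; $F^{(3)}$ is the compositum of all quadratic extensions $K$ of $F^{(2)}$ such that $K/F$ is Galois; the W-group is $\mathcal G_F=\mathrm{Gal}(F^{(3)}/F)$ and $\Phi_F$ is its Frattini subgroup. Elements are independent modulo $\Phi_F$ if their images in the $\mathbb F_2$-vector space $\mathcal G_F/\Phi_F$ are linearly independent. $\mathcal C$ is the category of pro-2-groups $G$ such that $g^4=1$ and $g^2$ is central for all $g\in G$. *)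

theory Defs
  imports "HOL-Algebra.Algebraic_Closure" "HOL-Algebra.Generated_Fields" "HOL-Algebra.Bij"
begin

definition char_zero_ring :: "('a, 'b) ring_scheme \<Rightarrow> bool" where
  "char_zero_ring R \<longleftrightarrow> (\<forall>n::nat. n > 0 \<longrightarrow> add_pow R n \<one>\<^bsub>R\<^esub> \<noteq> \<zero>\<^bsub>R\<^esub>)"

definition pythagorean :: "('a, 'b) ring_scheme \<Rightarrow> bool" where
  "pythagorean R \<longleftrightarrow> (\<forall>a\<in>carrier R. \<forall>b\<in>carrier R. \<exists>c\<in>carrier R.
      a \<otimes>\<^bsub>R\<^esub> a \<oplus>\<^bsub>R\<^esub> b \<otimes>\<^bsub>R\<^esub> b = c \<otimes>\<^bsub>R\<^esub> c)"

inductive_set sums_of_squares :: "('a, 'b) ring_scheme \<Rightarrow> 'a set" for R where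
  zero: "\<zero>\<^bsub>R\<^esub> \<in> sums_of_squares R"
| step: "s \<in> sums_of_squares R \<Longrightarrow> x \<in> carrier R \<Longrightarrow> s \<oplus>\<^bsub>R\<^esub> x \<otimes>\<^bsub>R\<^esub> x \<in> sums_of_squares R"

definition formally_real :: "('a, 'b) ring_scheme \<Rightarrow> bool" where
  "formally_real R \<longleftrightarrow> \<ominus>\<^bsub>R\<^esub> \<one>\<^bsub>R\<^esub> \<notin> sums_of_squares R"

text \<open>Inside a field L that is an algebraic closure of K: an intermediate field E is
  Galois over K (characteristic 0, so normal suffices): every element of E is a root
  of a nonzero polynomial over K all of whose roots in L lie in E.\<close>
definition galois_over :: "('a, 'b) ring_scheme \<Rightarrow> 'a set \<Rightarrow> 'a set \<Rightarrow> bool" where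
  "galois_over L K E \<longleftrightarrow> subfield E L \<and> K \<subseteq> E \<and>
     (\<forall>x\<in>E. \<exists>p \<in> carrier (K[X]\<^bsub>L\<^esub>). ring.is_root L p x \<and>
        (\<forall>y. ring.is_root L p y \<longrightarrow> y \<in> E))"

definition F2 :: "('a, 'b) ring_scheme \<Rightarrow> 'a set \<Rightarrow> 'a set" where
  "F2 L K = generate_field L (K \<union> {x \<in> carrier L. x \<otimes>\<^bsub>L\<^esub> x \<in> K})"

definition F3 :: "('a, 'b) ring_scheme \<Rightarrow> 'a set \<Rightarrow> 'a set" where
  "F3 L K = generate_field L (F2 L K \<union>
     {x \<in> carrier L. x \<otimes>\<^bsub>L\<^esub> x \<in> F2 L K \<and>
        galois_over L K (generate_field L (F2 L K \<union> {x}))})"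

definition galois_group :: "('a, 'b) ring_scheme \<Rightarrow> 'a set \<Rightarrow> 'a set \<Rightarrow> ('a \<Rightarrow> 'a) monoid" where
  "galois_group L K E = (BijGroup E)\<lparr>carrier :=
     {\<sigma> \<in> Bij E. \<sigma> \<in> ring_hom (L\<lparr>carrier := E\<rparr>) (L\<lparr>carrier := E\<rparr>) \<and> (\<forall>x\<in>K. \<sigma> x = x)}\<rparr>"

definition W_group :: "('a, 'b) ring_scheme \<Rightarrow> 'a set \<Rightarrow> ('a \<Rightarrow> 'a) monoid" where
  "W_group L K = galois_group L K (F3 L K)"

definition frattini :: "('g, 'c) monoid_scheme \<Rightarrow> 'g set" where
  "frattini G = carrier G \<inter> \<Inter>{M. subgroup M G \<and> M \<noteq> carrier G \<and>
      (\<forall>N. subgroup N G \<and> M \<subseteq> N \<longrightarrow> N = M \<or> N = carrier G)}"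

text \<open>Elements independent modulo a normal subgroup N with elementary abelian 2-quotient:
  no nonempty subfamily has product in N (linear independence over F_2 in G/N).\<close>
definition indep_mod :: "('g, 'c) monoid_scheme \<Rightarrow> 'g set \<Rightarrow> 'g list \<Rightarrow> bool" where
  "indep_mod G N gs \<longleftrightarrow> (\<forall>S \<subseteq> {..<length gs}. S \<noteq> {} \<longrightarrow>
      foldr (\<otimes>\<^bsub>G\<^esub>) (nths gs S) \<one>\<^bsub>G\<^esub> \<notin> N)"

text \<open>Words in the letters 0..4 (letter i stands for sigma_(i+1)).  The congruence
  generated by the defining relations of C (g^4 = 1, g^2 central) and the relations
  of the presentation.  The quotient monoid is a group (inverse of g is g^3); since
  free objects of C on finitely many generators are finite, this coincides with the
  pro-2 presentation in C.\<close>
definition letters5 :: "nat list set" where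
  "letters5 = {w. set w \<subseteq> {..<5}}"

inductive wrel :: "nat list \<Rightarrow> nat list \<Rightarrow> bool" where
  refl: "w \<in> letters5 \<Longrightarrow> wrel w w"
| sym: "wrel u v \<Longrightarrow> wrel v u"
| trans: "wrel u v \<Longrightarrow> wrel v w \<Longrightarrow> wrel u w"
| cong: "wrel a b \<Longrightarrow> wrel c d \<Longrightarrow> wrel (a @ c) (b @ d)"
| exp4: "w \<in> letters5 \<Longrightarrow> wrel (w @ w @ w @ w) []"
| central: "w \<in> letters5 \<Longrightarrow> v \<in> letters5 \<Longrightarrow> wrel (w @ w @ v) (v @ w @ w)"
| invol: "i < 5 \<Longrightarrow> wrel [i, i] []"
| prod: "wrel ([0,1,2,3,4] @ [0,1,2,3,4]) []"

definition wclass :: "nat list \<Rightarrow> nat list set" where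
  "wclass w = {v. wrel w v}"

definition W5 :: "nat list set monoid" where
  "W5 = \<lparr>carrier = wclass ` letters5,
         monoid.mult = (\<lambda>A B. wclass ((SOME x. x \<in> A) @ (SOME y. y \<in> B))),
         monoid.one = wclass []\<rparr>"

definition W5_gens :: "nat list set list" where
  "W5_gens = map (\<lambda>i. wclass [i]) [0..<5]"

end

theory Submission
  imports Defs
begin

text \<open>
  Number the generators 0, ..., 4 and put \<open>\<sigma> = \<sigma>\<^sub>0 \<cdots> \<sigma>\<^sub>4\<close>, a sixth involution. Attach to \<open>a \<in> K\<close> the
  set of those of the six involutions that negate \<open>\<surd>a\<close>; it has an even number of elements, and every
  even set occurs.

  Write \<open>(a, b) = 0\<close> if \<open>b = x\<^sup>2 - a y\<^sup>2\<close> has a solution in \<open>K\<close>. Then \<open>F3\<close> contains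
  \<open>\<omega> = \<surd>(x + y \<surd>a)\<close>, and an automorphism negating both \<open>\<surd>a\<close> and \<open>\<surd>b\<close> sends \<open>\<omega>\<close> to \<open>\<plusminus>\<surd>b/\<omega>\<close>,
  so its square sends \<open>\<omega>\<close> to \<open>-\<omega>\<close>: the sets of \<open>a\<close> and \<open>b\<close> are disjoint. Conversely, disjoint sets give
  a homomorphism from the W-group onto the dihedral group of order 8, and a two-dimensional
  representation of that group inside \<open>F3\<close> solves \<open>b = x\<^sup>2 - a y\<^sup>2\<close>.

  Hence there are \<open>a, b, c, d\<close> with sets \<open>{1,3,4,\<sigma>}\<close>, \<open>{0,1}\<close>, \<open>{0,1,2,3}\<close>, \<open>{1,4}\<close> and with
  \<open>(ad, b) = (d, bc) = 0\<close>, so that the quaternion algebras \<open>(a, b)\<close>, \<open>(d, b)\<close>, \<open>(d, c)\<close> agree. By the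
  common slot lemma some \<open>f \<in> K\<close> satisfies \<open>(a, bf) = (c, df) = 0\<close>. Then the set of \<open>f\<close> meets
  \<open>{1,3,4,\<sigma>}\<close> and \<open>{0,1,2,3}\<close> in \<open>{1}\<close> only, so it is the odd set \<open>{1}\<close>, which is impossible.
\<close>

section \<open>Extension of field homomorphisms\<close>

lemma (in domain) square_eq_iff:
  assumes "u \<in> carrier R" "v \<in> carrier R"
  shows "u \<otimes> u = v \<otimes> v \<longleftrightarrow> u = v \<or> u = \<ominus> v"
proof
  assume eq: "u \<otimes> u = v \<otimes> v"
  have "(u \<ominus> v) \<otimes> (u \<oplus> v) = u \<otimes> u \<ominus> v \<otimes> v"
    using assms by algebra
  also have "\<dots> = \<zero>"
    using assms eq by simp
  finally have "u \<ominus> v = \<zero> \<or> u \<oplus> v = \<zero>"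
    using assms integral_iff by simp
  thus "u = v \<or> u = \<ominus> v"
    using assms r_right_minus_eq minus_equality by auto
next
  assume "u = v \<or> u = \<ominus> v"
  thus "u \<otimes> u = v \<otimes> v"
    using assms by (auto simp: l_minus r_minus)
qed

lemma (in field) square_root_subfield:
  assumes "subfield E R" "u \<in> carrier R" "v \<in> E" "u \<otimes> u = v \<otimes> v"
  shows "u \<in> E"
proof -
  have "v \<in> carrier R" "\<ominus> v \<in> E"
    using assms(3) subfieldE(3)[OF assms(1)] subringE(5)[OF subfieldE(1)[OF assms(1)]] by auto
  thus ?thesis
    using assms(2-4) square_eq_iff[of u v] by auto
qed

lemma (in algebraically_closed) exists_square_root:
  assumes "a \<in> carrier L"
  obtains u where "u \<in> carrier L" "u \<otimes> u = a"
proof -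
  let ?p = "[\<one>, \<zero>, \<ominus> a]"
  have p: "?p \<in> carrier (poly_ring L)"
    using assms by (auto simp: univ_poly_def polynomial_def)
  have "size (roots ?p) = 2"
    using roots_over_carrier[OF p] unfolding splitted_def by simp
  then obtain u where "u \<in># roots ?p"
    by (metis multiset_nonemptyE size_empty zero_neq_numeral)
  hence "is_root ?p u"
    using roots_mem_iff_is_root[OF p] by simp
  hence u: "u \<in> carrier L" and "eval ?p u = \<zero>"
    unfolding is_root_def by auto
  hence "u \<otimes> u \<ominus> a = \<zero>"
    using assms by (simp add: a_minus_def numeral_2_eq_2)
  thus thesis
    using that[OF u] u assms by simp
qed

text \<open>\<open>E\<close> is only a subring here, so \<open>\<tau>\<close> may kill a leading
  coefficient and \<open>map \<tau> p\<close> may start with zeros. Evaluation ignores leading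
  zeros, hence identities that hold after \<open>normalize\<close> suffice.\<close>

lemma (in domain) hom_eval_poly:
  assumes E: "subring E R" and h: "\<tau> \<in> ring_hom (R\<lparr>carrier := E\<rparr>) R" and y: "y \<in> carrier R"
  shows "(\<lambda>p. eval (map \<tau> p) y) \<in> ring_hom (E[X]) R"
proof -
  interpret T: ring_hom_ring "R\<lparr>carrier := E\<rparr>" R \<tau>
    using ring_hom_ringI2[OF subring_is_ring[OF E] ring_axioms h] .
  have cl: "set p \<subseteq> E \<Longrightarrow> set (map \<tau> p) \<subseteq> carrier R" for p
    using T.hom_closed by auto
  have set: "p \<in> carrier (E[X]) \<Longrightarrow> set p \<subseteq> E" for p
    by (simp add: univ_poly_carrier[symmetric] polynomial_incl)
  show ?thesis
  proof (rule ring_hom_memI)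
    fix p assume "p \<in> carrier (E[X])"
    thus "eval (map \<tau> p) y \<in> carrier R"
      using eval_in_carrier[OF cl[OF set] y] by simp
  next
    fix p q assume "p \<in> carrier (E[X])" "q \<in> carrier (E[X])"
    note pq = set[OF this(1)] set[OF this(2)]
    have "normalize (map \<tau> (poly_mult p q)) = poly_mult (map \<tau> p) (map \<tau> q)"
      using T.poly_mult_hom'[of p q] pq poly_mult_consistent[OF E] by simp
    moreover have "set (map \<tau> (poly_mult p q)) \<subseteq> carrier R"
      using cl[OF polynomial_incl[OF poly_mult_is_polynomial[OF E pq]]] .
    ultimately show "eval (map \<tau> (p \<otimes>\<^bsub>E[X]\<^esub> q)) y = eval (map \<tau> p) y \<otimes> eval (map \<tau> q) y"
      using eval_normalize[of "map \<tau> (poly_mult p q)" y] eval_poly_mult[OF cl[OF pq(1)] cl[OF pq(2)] y] y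
      by (simp add: univ_poly_mult)
  next
    fix p q assume "p \<in> carrier (E[X])" "q \<in> carrier (E[X])"
    note pq = set[OF this(1)] set[OF this(2)]
    have "normalize (map \<tau> (poly_add p q)) = poly_add (map \<tau> p) (map \<tau> q)"
      using T.poly_add_hom'[of p q] pq poly_add_consistent[OF E] by simp
    moreover have "set (map \<tau> (poly_add p q)) \<subseteq> carrier R"
      using cl[OF polynomial_incl[OF poly_add_is_polynomial[OF E pq]]] .
    ultimately show "eval (map \<tau> (p \<oplus>\<^bsub>E[X]\<^esub> q)) y = eval (map \<tau> p) y \<oplus> eval (map \<tau> q) y"
      using eval_normalize[of "map \<tau> (poly_add p q)" y] eval_poly_add[OF cl[OF pq(1)] cl[OF pq(2)] y] y
      by (simp add: univ_poly_add)
  next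
    show "eval (map \<tau> \<one>\<^bsub>E[X]\<^esub>) y = \<one>"
      using T.hom_one y by (simp add: univ_poly_one)
  qed
qed

text \<open>Evaluation at \<open>x\<close> identifies \<open>E[X]\<close> modulo
  \<open>Irr E x\<close> with \<open>simple_extension E x\<close>. Since \<open>y\<close> is a root
  of the transported polynomial, \<open>p \<mapsto> eval (map \<tau> p) y\<close> kills
  \<open>Irr E x\<close> and factors through that evaluation.\<close>

lemma (in field) hom_extend_simple:
  assumes E: "subfield E R" and h: "\<tau> \<in> ring_hom (R\<lparr>carrier := E\<rparr>) R"
    and x: "x \<in> carrier R" "(algebraic over E) x"
    and y: "y \<in> carrier R" "eval (map \<tau> (Irr E x)) y = \<zero>"
  obtains \<tau>' where "\<tau>' \<in> ring_hom (R\<lparr>carrier := simple_extension E x\<rparr>) R"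
    "\<And>e. e \<in> E \<Longrightarrow> \<tau>' e = \<tau> e" "\<tau>' x = y"
proof -
  note subr = subfieldE(1)[OF E]
  let ?h = "\<lambda>p. eval (map \<tau> p) y"
  interpret T: ring_hom_ring "R\<lparr>carrier := E\<rparr>" R \<tau>
    using ring_hom_ringI2[OF subring_is_ring[OF subr] ring_axioms h] .
  interpret UP: domain "E[X]"
    using univ_poly_is_domain[OF subr] .
  interpret H: ring_hom_ring "E[X]" R ?h
    using ring_hom_ringI2[OF UP.ring_axioms ring_axioms hom_eval_poly[OF subr h y(1)]] .
  interpret V: ring_hom_ring "E[X]" R "\<lambda>p. eval p x"
    using eval_ring_hom[OF subr x(1)] .
  note Irr = IrrE[OF E x]
  have ker: "?h q = \<zero>" if q: "q \<in> carrier (E[X])" "eval q x = \<zero>" for q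
  proof -
    have "Irr E x divides\<^bsub>E[X]\<^esub> q"
      using Irr_minimal[OF E x q] pdivides_iff_shell[OF E Irr(1) q(1)] by simp
    then obtain r where "r \<in> carrier (E[X])" "q = Irr E x \<otimes>\<^bsub>E[X]\<^esub> r"
      unfolding factor_def by auto
    thus ?thesis
      using H.hom_mult[OF Irr(1)] y(2) by simp
  qed
  have well: "?h p = ?h q" if "p \<in> carrier (E[X])" "q \<in> carrier (E[X])" "eval p x = eval q x" for p q
  proof -
    have "eval (p \<ominus>\<^bsub>E[X]\<^esub> q) x = \<zero>"
      using that V.hom_closed[OF that(2)] by (simp add: a_minus_def r_neg)
    hence "?h (p \<ominus>\<^bsub>E[X]\<^esub> q) = \<zero>"
      using ker that(1,2) by blast
    hence "?h p \<ominus> ?h q = \<zero>"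
      using that(1,2) by (simp add: a_minus_def)
    thus ?thesis
      using that H.hom_closed r_right_minus_eq by blast
  qed
  \<comment> \<open>An arbitrary polynomial is chosen for each value \<open>u\<close>; by
    \<open>well\<close> the choice does not affect the result.\<close>
  define t where "t u = ?h (SOME q. q \<in> carrier (E[X]) \<and> eval q x = u)" for u
  have t: "t (eval q x) = ?h q" if "q \<in> carrier (E[X])" for q
  proof -
    have "\<exists>p. p \<in> carrier (E[X]) \<and> eval p x = eval q x"
      using that by blast
    from someI_ex[OF this] show ?thesis
      unfolding t_def using well that by blast
  qed
  have img: "simple_extension E x = (\<lambda>p. eval p x) ` carrier (E[X])"
    using simple_extension_as_eval_img[OF subfieldE(3)[OF E] x(1)] .
  have "t \<in> ring_hom (R\<lparr>carrier := simple_extension E x\<rparr>) R"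
  proof (rule ring_hom_memI)
    show "t u \<in> carrier R" if "u \<in> carrier (R\<lparr>carrier := simple_extension E x\<rparr>)" for u
      using that t H.hom_closed unfolding img by auto
    fix u v assume "u \<in> carrier (R\<lparr>carrier := simple_extension E x\<rparr>)"
      "v \<in> carrier (R\<lparr>carrier := simple_extension E x\<rparr>)"
    then obtain p q where pq: "p \<in> carrier (E[X])" "q \<in> carrier (E[X])" "u = eval p x" "v = eval q x"
      unfolding img by auto
    show "t (u \<otimes>\<^bsub>R\<lparr>carrier := simple_extension E x\<rparr>\<^esub> v) = t u \<otimes> t v"
      using t[of "p \<otimes>\<^bsub>E[X]\<^esub> q"] t pq by simp
    show "t (u \<oplus>\<^bsub>R\<lparr>carrier := simple_extension E x\<rparr>\<^esub> v) = t u \<oplus> t v"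
      using t[of "p \<oplus>\<^bsub>E[X]\<^esub> q"] t pq by simp
  next
    show "t \<one>\<^bsub>R\<lparr>carrier := simple_extension E x\<rparr>\<^esub> = \<one>"
      using t[OF UP.one_closed] V.hom_one H.hom_one by simp
  qed
  moreover have "t e = \<tau> e" if e: "e \<in> E" for e
  proof (cases "e = \<zero>")
    case True
    have "t (eval [] x) = \<zero>"
      using t[of "[]"] by (simp add: univ_poly_def polynomial_def)
    thus ?thesis
      using True T.hom_zero by simp
  next
    case False
    hence "[e] \<in> carrier (E[X])"
      using e by (auto simp: univ_poly_def polynomial_def)
    from t[OF this] show ?thesis
      using e x(1) y(1) T.hom_closed[of e] subfieldE(3)[OF E] by (simp add: subset_iff)
  qed
  moreover have "t x = y"
    using t[OF var_closed(1)[OF subr]] eval_var[OF x(1)] eval_var[OF y(1)] T.hom_one T.hom_zero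
    by (simp add: var_def)
  ultimately show thesis
    using that by blast
qed

text \<open>A homomorphism from a subfield into the field, encoded by its graph: extension becomes
  inclusion, so Zorn's lemma for sets applies directly.\<close>

definition (in field) partial_hom :: "('a \<times> 'a) set \<Rightarrow> bool" where
  "partial_hom g \<longleftrightarrow> subfield (Domain g) R \<and> single_valued g \<and> Range g \<subseteq> carrier R \<and> (\<one>, \<one>) \<in> g \<and>
     (\<forall>a b c d. (a, b) \<in> g \<longrightarrow> (c, d) \<in> g \<longrightarrow> (a \<oplus> c, b \<oplus> d) \<in> g \<and> (a \<otimes> c, b \<otimes> d) \<in> g)"

lemma (in field) partial_hom_graph:
  assumes "subfield E R" "\<tau> \<in> ring_hom (R\<lparr>carrier := E\<rparr>) R"
  shows "partial_hom ((\<lambda>e. (e, \<tau> e)) ` E)"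
proof -
  have "Domain ((\<lambda>e. (e, \<tau> e)) ` E) = E"
    by force
  thus ?thesis
    using assms subfieldE(1,3)[OF assms(1)] subringE(3,6,7)[OF subfieldE(1)[OF assms(1)]]
    unfolding partial_hom_def by (auto simp: single_valued_def ring_hom_def image_iff)
qed

lemma (in field) partial_homE:
  assumes "partial_hom g"
  obtains \<tau> where "\<tau> \<in> ring_hom (R\<lparr>carrier := Domain g\<rparr>) R" "g = (\<lambda>e. (e, \<tau> e)) ` Domain g"
proof -
  define t where "t a = (THE b. (a, b) \<in> g)" for a
  have sv: "single_valued g"
    using assms unfolding partial_hom_def by simp
  have t: "t a = b" if "(a, b) \<in> g" for a b
    unfolding t_def using that single_valuedD[OF sv] by blast
  have "t \<in> ring_hom (R\<lparr>carrier := Domain g\<rparr>) R"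
  proof (rule ring_hom_memI)
    fix a assume "a \<in> carrier (R\<lparr>carrier := Domain g\<rparr>)"
    then obtain b where "(a, b) \<in> g" by auto
    thus "t a \<in> carrier R"
      using t assms unfolding partial_hom_def by blast
  next
    fix a c assume "a \<in> carrier (R\<lparr>carrier := Domain g\<rparr>)" "c \<in> carrier (R\<lparr>carrier := Domain g\<rparr>)"
    then obtain b d where "(a, b) \<in> g" "(c, d) \<in> g" by auto
    moreover from this have "(a \<otimes> c, b \<otimes> d) \<in> g" "(a \<oplus> c, b \<oplus> d) \<in> g"
      using assms unfolding partial_hom_def by blast+
    ultimately show "t (a \<otimes>\<^bsub>R\<lparr>carrier := Domain g\<rparr>\<^esub> c) = t a \<otimes> t c"
      "t (a \<oplus>\<^bsub>R\<lparr>carrier := Domain g\<rparr>\<^esub> c) = t a \<oplus> t c"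
      using t by simp_all
  next
    show "t \<one>\<^bsub>R\<lparr>carrier := Domain g\<rparr>\<^esub> = \<one>"
      using t assms unfolding partial_hom_def by simp
  qed
  moreover have "g = (\<lambda>e. (e, t e)) ` Domain g"
    using t by force
  ultimately show thesis
    using that by blast
qed

text \<open>Each condition in \<open>partial_hom\<close> concerns at most two pairs, and two pairs
  from a chain lie in one common member.\<close>

lemma (in field) partial_hom_Union_chain:
  assumes ne: "C \<noteq> {}" and chain: "\<And>g h. g \<in> C \<Longrightarrow> h \<in> C \<Longrightarrow> g \<subseteq> h \<or> h \<subseteq> g"
    and hom: "\<And>g. g \<in> C \<Longrightarrow> partial_hom g"
  shows "partial_hom (\<Union>C)"
proof -
  have common: "\<exists>g\<in>C. p \<in> g \<and> q \<in> g" if "p \<in> \<Union>C" "q \<in> \<Union>C" for p q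
    using that chain by blast
  have sf: "g \<in> C \<Longrightarrow> subfield (Domain g) R" for g
    using hom unfolding partial_hom_def by simp
  have dom: "\<exists>g\<in>C. a \<in> Domain g \<and> b \<in> Domain g" if "a \<in> Domain (\<Union>C)" "b \<in> Domain (\<Union>C)" for a b
  proof -
    from that obtain a' b' where "(a, a') \<in> \<Union>C" "(b, b') \<in> \<Union>C" by auto
    from common[OF this] show ?thesis by blast
  qed
  have sub: "g \<in> C \<Longrightarrow> Domain g \<subseteq> Domain (\<Union>C)" for g
    by blast
  obtain g0 where "g0 \<in> C"
    using ne by blast
  hence one: "(\<one>, \<one>) \<in> \<Union>C"
    using hom[of g0] unfolding partial_hom_def by blast
  have "subfield (Domain (\<Union>C)) R"
  proof (rule subfieldI')
    show "subring (Domain (\<Union>C)) R"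
    proof (rule subringI)
      show "Domain (\<Union>C) \<subseteq> carrier R"
      proof
        fix a assume "a \<in> Domain (\<Union>C)"
        then obtain g where g: "g \<in> C" "a \<in> Domain g" by blast
        show "a \<in> carrier R"
          using subfieldE(3)[OF sf[OF g(1)]] g(2) by blast
      qed
      show "\<one> \<in> Domain (\<Union>C)"
        using one by blast
      show "\<ominus> a \<in> Domain (\<Union>C)" if "a \<in> Domain (\<Union>C)" for a
      proof -
        obtain g where g: "g \<in> C" "a \<in> Domain g"
          using \<open>a \<in> Domain (\<Union>C)\<close> by blast
        show ?thesis
          using subringE(5)[OF subfieldE(1)[OF sf[OF g(1)]] g(2)] sub[OF g(1)] by blast
      qed
      fix a b assume "a \<in> Domain (\<Union>C)" "b \<in> Domain (\<Union>C)"
      then obtain g where g: "g \<in> C" "a \<in> Domain g" "b \<in> Domain g"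
        using dom by blast
      show "a \<otimes> b \<in> Domain (\<Union>C)" "a \<oplus> b \<in> Domain (\<Union>C)"
        using subringE(6,7)[OF subfieldE(1)[OF sf[OF g(1)]] g(2,3)] sub[OF g(1)] by auto
    qed
    fix a assume a: "a \<in> Domain (\<Union>C) - {\<zero>}"
    then obtain g where g: "g \<in> C" "a \<in> Domain g"
      by blast
    have "inv a \<in> Domain g"
      using subfield_m_inv(1)[OF sf[OF g(1)]] g(2) a by blast
    thus "inv a \<in> Domain (\<Union>C)"
      using sub[OF g(1)] by auto
  qed
  moreover have "single_valued (\<Union>C)"
  proof (rule single_valuedI)
    fix a b c assume "(a, b) \<in> \<Union>C" "(a, c) \<in> \<Union>C"
    then obtain g where "g \<in> C" "(a, b) \<in> g" "(a, c) \<in> g"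
      using common by blast
    thus "b = c"
      using hom[of g] unfolding partial_hom_def single_valued_def by blast
  qed
  moreover have "Range (\<Union>C) \<subseteq> carrier R"
  proof
    fix b assume "b \<in> Range (\<Union>C)"
    then obtain g where "g \<in> C" "b \<in> Range g" by blast
    thus "b \<in> carrier R"
      using hom[of g] unfolding partial_hom_def by blast
  qed
  moreover note one
  moreover have "(a \<oplus> c, b \<oplus> d) \<in> \<Union>C \<and> (a \<otimes> c, b \<otimes> d) \<in> \<Union>C"
    if "(a, b) \<in> \<Union>C" "(c, d) \<in> \<Union>C" for a b c d
  proof -
    obtain g where "g \<in> C" "(a, b) \<in> g" "(c, d) \<in> g"
      using common[OF \<open>(a, b) \<in> \<Union>C\<close> \<open>(c, d) \<in> \<Union>C\<close>] by blast
    thus ?thesis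
      using hom[of g] unfolding partial_hom_def by blast
  qed
  ultimately show ?thesis
    unfolding partial_hom_def by simp
qed

text \<open>\<open>map \<tau>\<close> keeps the leading coefficient 1, so the image of
  \<open>Irr E x\<close> is still a polynomial of positive degree and has a root in the
  algebraically closed field.\<close>

lemma (in algebraic_closure) hom_poly_root:
  assumes E: "subfield E L" "K \<subseteq> E" and h: "\<tau> \<in> ring_hom (L\<lparr>carrier := E\<rparr>) L"
    and x: "x \<in> carrier L"
  obtains y where "y \<in> carrier L" "eval (map \<tau> (Irr E x)) y = \<zero>"
proof -
  have alg: "(algebraic over E) x"
    using algebraic_mono[OF E(2) algebraic_extension[OF x]] .
  interpret T: ring_hom_ring "L\<lparr>carrier := E\<rparr>" L \<tau>
    using ring_hom_ringI2[OF subring_is_ring[OF subfieldE(1)[OF E(1)]] ring_axioms h] .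
  note Irr = IrrE[OF E(1) x alg]
  let ?p = "map \<tau> (Irr E x)"
  have deg: "degree (Irr E x) \<ge> 1"
    using pirreducible_degree[OF E(1) Irr(1,2)] .
  have ne: "Irr E x \<noteq> []"
    using deg by auto
  have "set (Irr E x) \<subseteq> E"
    using Irr(1) by (simp add: univ_poly_carrier[symmetric] polynomial_incl)
  hence "set ?p \<subseteq> carrier L"
    using T.hom_closed by auto
  moreover have "lead_coeff ?p = \<one>"
    using ne Irr(3) T.hom_one by (simp add: list.map_sel(1))
  ultimately have p: "?p \<in> carrier (poly_ring L)"
    by (simp add: univ_poly_carrier[symmetric] polynomial_def)
  have "size (roots ?p) \<noteq> 0"
    using roots_over_carrier[OF p] deg unfolding splitted_def by simp
  then obtain y where "y \<in># roots ?p"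
    by (metis multiset_nonemptyE size_empty)
  thus thesis
    using that roots_mem_iff_is_root[OF p] unfolding is_root_def by blast
qed

text \<open>A maximal extension exists by Zorn's lemma. Its domain \<open>D\<close> contains
  \<open>K\<close>, over which every element is algebraic, so an element outside \<open>D\<close>
  would permit a further simple extension.\<close>

lemma (in algebraic_closure) hom_extend:
  assumes E: "subfield E L" "K \<subseteq> E" and h: "\<tau> \<in> ring_hom (L\<lparr>carrier := E\<rparr>) L"
  obtains \<tau>' where "\<tau>' \<in> ring_hom L L" "\<And>e. e \<in> E \<Longrightarrow> \<tau>' e = \<tau> e"
proof -
  define g0 where "g0 = (\<lambda>e. (e, \<tau> e)) ` E"
  define A where "A = {g. partial_hom g \<and> g0 \<subseteq> g}"
  have "A \<noteq> {}"
    using partial_hom_graph[OF E(1) h] unfolding A_def g0_def by auto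
  moreover have "\<Union>C \<in> A" if "C \<noteq> {}" "subset.chain A C" for C
  proof -
    have C: "\<And>g. g \<in> C \<Longrightarrow> partial_hom g \<and> g0 \<subseteq> g" "\<And>g h. g \<in> C \<Longrightarrow> h \<in> C \<Longrightarrow> g \<subseteq> h \<or> h \<subseteq> g"
      using that(2) unfolding A_def subset_chain_def by auto
    have "partial_hom (\<Union>C)"
      by (rule partial_hom_Union_chain[OF that(1)]) (use C in auto)
    moreover have "g0 \<subseteq> \<Union>C"
      using C(1) that(1) by blast
    ultimately show ?thesis
      unfolding A_def by simp
  qed
  ultimately have "\<exists>g\<in>A. \<forall>h\<in>A. g \<subseteq> h \<longrightarrow> h = g"
    by (rule subset_Zorn_nonempty)
  then obtain g where g: "g \<in> A" and max: "\<And>h. h \<in> A \<Longrightarrow> g \<subseteq> h \<Longrightarrow> h = g"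
    by blast
  have pg: "partial_hom g" "g0 \<subseteq> g"
    using g unfolding A_def by auto
  define D where "D = Domain g"
  obtain t where t: "t \<in> ring_hom (L\<lparr>carrier := D\<rparr>) L" and gt: "g = (\<lambda>e. (e, t e)) ` D"
    by (rule partial_homE[OF pg(1), folded D_def])
  have D: "subfield D L"
    using pg(1) unfolding partial_hom_def D_def by simp
  have ED: "E \<subseteq> D"
    using pg(2) unfolding g0_def D_def by (auto dest: subsetD)
  have tE: "t e = \<tau> e" if "e \<in> E" for e
  proof -
    have "(e, \<tau> e) \<in> g"
      using pg(2) that unfolding g0_def by blast
    thus ?thesis
      by (subst (asm) gt) auto
  qed
  have "x \<in> D" if x: "x \<in> carrier L" for x
  proof -
    have KD: "K \<subseteq> D"
      using E(2) ED by blast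
    have alg: "(algebraic over D) x"
      using algebraic_mono[OF KD algebraic_extension[OF x]] .
    obtain y where y: "y \<in> carrier L" "eval (map t (Irr D x)) y = \<zero>"
      using hom_poly_root[OF D KD t x] .
    let ?S = "simple_extension D x"
    obtain t' where t': "t' \<in> ring_hom (L\<lparr>carrier := ?S\<rparr>) L" "\<And>e. e \<in> D \<Longrightarrow> t' e = t e" "t' x = y"
      by (rule hom_extend_simple[OF D t x alg y]) blast
    have S: "subfield ?S L" "D \<subseteq> ?S" "x \<in> ?S"
      using simple_extension_is_subfield[OF D x] alg simple_extension_incl[OF subfieldE(3)[OF D] x]
        simple_extension_mem[OF subfieldE(1)[OF D] x] by auto
    have "g \<subseteq> (\<lambda>e. (e, t' e)) ` ?S"
      using S(2) t'(2) by (subst gt) (auto simp: subset_iff)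
    moreover from this have "(\<lambda>e. (e, t' e)) ` ?S \<in> A"
      using partial_hom_graph[OF S(1) t'(1)] pg(2) unfolding A_def by simp
    ultimately have "(\<lambda>e. (e, t' e)) ` ?S = g"
      using max by simp
    thus ?thesis
      using S(3) unfolding D_def by (metis DomainI imageI)
  qed
  hence "D = carrier L"
    using subfieldE(3)[OF D] by blast
  thus thesis
    using that[of t] t tE by simp
qed

section \<open>Endomorphisms of the algebraic closure\<close>

text \<open>This recurrence serves to split off a linear factor. \<open>coeff\<close> is indexed by
  the power of the variable, so multiplication by the variable shifts the index by one.\<close>

lemma (in domain) coeff_mult_linear:
  assumes "set q \<subseteq> carrier R" "x \<in> carrier R"
  shows "coeff (poly_mult [\<one>, \<ominus> x] q) i = (if i = 0 then \<zero> else coeff q (i - 1)) \<ominus> x \<otimes> coeff q i"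
proof -
  have c: "set (map ((\<otimes>) (\<ominus> x)) q) \<subseteq> carrier R" "set (map ((\<otimes>) \<one>) q @ [\<zero>]) \<subseteq> carrier R"
    using assms by auto
  have q: "coeff q j \<in> carrier R" for j
    using assms(1) by simp
  have "set (poly_add (map ((\<otimes>) (\<ominus> x)) q) []) \<subseteq> carrier R"
    by (rule poly_add_in_carrier[OF c(1)]) simp
  hence "coeff (poly_mult [\<one>, \<ominus> x] q) i
      = coeff (map ((\<otimes>) \<one>) q @ [\<zero>]) i \<oplus> coeff (poly_add (map ((\<otimes>) (\<ominus> x)) q) []) i"
    using poly_add_coeff[OF c(2)] by (simp del: poly_add.simps)
  also have "coeff (poly_add (map ((\<otimes>) (\<ominus> x)) q) []) i = (\<ominus> x) \<otimes> coeff q i"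
    using poly_add_coeff[OF c(1), of "[]"] scalar_coeff[of "\<ominus> x" q] assms(2) q
    by (simp del: poly_add.simps)
  also have "coeff (map ((\<otimes>) \<one>) q @ [\<zero>]) i = (if i = 0 then \<zero> else coeff q (i - 1))"
    using append_coeff[of "map ((\<otimes>) \<one>) q" "[\<zero>]"] scalar_coeff[of \<one> q] q by simp
  finally show ?thesis
    using assms(2) q by (simp add: a_minus_def l_minus)
qed

text \<open>Such a polynomial is c (X - x)^n, whose coefficient next to the leading one is -n x c.
  In characteristic zero this recovers x from the coefficients. The case distinction guards against
  truncated subtraction at n = 0.\<close>

lemma (in field) coeff_single_root:
  assumes "p \<in> carrier (poly_ring R)" "p \<noteq> []" "x \<in> carrier R"
    and "roots p = replicate_mset n x" "degree p = n"
  shows "(if n = 0 then \<zero> else coeff p (n - 1)) = \<ominus> (add_pow R n x \<otimes> lead_coeff p)"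
  using assms
proof (induction n arbitrary: p)
  case 0
  have "set p \<subseteq> carrier R"
    using 0(1) by (simp add: univ_poly_carrier[symmetric] polynomial_incl)
  hence "lead_coeff p \<in> carrier R"
    using 0(2) by (auto simp: subset_iff)
  thus ?case
    by simp
next
  case (Suc m)
  have "is_root p x"
    using Suc.prems(4) roots_mem_iff_is_root[OF Suc.prems(1), of x] by simp
  hence "[\<one>, \<ominus> x] pdivides p"
    using is_root_imp_pdivides[OF Suc.prems(1)] by blast
  then obtain q where q: "q \<in> carrier (poly_ring R)" and p: "p = [\<one>, \<ominus> x] \<otimes>\<^bsub>poly_ring R\<^esub> q"
    unfolding pdivides_def factor_def by auto
  interpret UP: domain "poly_ring R"
    using univ_poly_is_domain[OF carrier_is_subring] .
  have lin: "[\<one>, \<ominus> x] \<in> carrier (poly_ring R)"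
    using Suc.prems(3) by (simp add: univ_poly_carrier[symmetric] polynomial_def)
  have q0: "q \<noteq> []"
    using Suc.prems(2) p lin UP.r_null[OF lin] by (auto simp: univ_poly_zero)
  have "degree p = Suc (degree q)"
    using poly_mult_degree_eq[OF carrier_is_subring, of "[\<one>, \<ominus> x]" q] lin q q0 p
    unfolding univ_poly_carrier[symmetric] univ_poly_mult by simp
  hence deg: "degree q = m"
    using Suc.prems(5) by simp
  have "add_mset x (roots q) = replicate_mset (Suc m) x"
    using poly_mult_degree_one_monic_imp_same_roots[OF Suc.prems(3) q q0] p Suc.prems(4) by simp
  hence rts: "roots q = replicate_mset m x"
    by simp
  have sq: "set q \<subseteq> carrier R"
    using q by (simp add: univ_poly_carrier[symmetric] polynomial_incl)
  have pm: "p = poly_mult [\<one>, \<ominus> x] q"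
    using p by (simp add: univ_poly_mult)
  have lq: "coeff q m = lead_coeff q" "lead_coeff q \<in> carrier R"
    using lead_coeff_simp[OF q0] deg q0 sq by (auto simp: subset_iff)
  have "coeff q (Suc m) = \<zero>"
    using coeff_degree[of q "Suc m"] deg by simp
  hence lp: "lead_coeff p = lead_coeff q"
    using lead_coeff_simp[OF Suc.prems(2)] Suc.prems(3,5) coeff_mult_linear[OF sq Suc.prems(3), of "Suc m"] lq
    unfolding pm[symmetric] by (simp add: a_minus_def)
  have *: "(\<ominus> (a \<otimes> c)) \<ominus> x \<otimes> c = \<ominus> ((a \<oplus> x) \<otimes> c)"
    if "a \<in> carrier R" "c \<in> carrier R" for a c
    using that Suc.prems(3) by algebra
  have "coeff p m = (if m = 0 then \<zero> else coeff q (m - 1)) \<ominus> x \<otimes> lead_coeff q"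
    using coeff_mult_linear[OF sq Suc.prems(3), of m] lq unfolding pm[symmetric] by simp
  also have "\<dots> = (\<ominus> (add_pow R m x \<otimes> lead_coeff q)) \<ominus> x \<otimes> lead_coeff q"
    using Suc.IH[OF q q0 Suc.prems(3) rts deg] by simp
  also have "\<dots> = \<ominus> ((add_pow R m x \<oplus> x) \<otimes> lead_coeff q)"
    using *[OF add.nat_pow_closed[OF Suc.prems(3)] lq(2)] .
  finally show ?case
    using lp by simp
qed

section \<open>Endomorphisms over \<open>K\<close> and their fixed field\<close>

lemma (in ring) coeff_in_subring:
  assumes "subring E R" "set p \<subseteq> E"
  shows "coeff p i \<in> E"
proof -
  have "coeff p i \<in> set p \<union> {\<zero>}"
    unfolding coeff_img(3)[of p, symmetric] by (rule rangeI)
  thus ?thesis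
    using assms(2) subringE(2)[OF assms(1)] by auto
qed

lemma (in ring) add_pow_one_in_subring:
  assumes "subring E R"
  shows "add_pow R (n::nat) \<one> \<in> E"
  by (induction n) (use subringE(2,3,7)[OF assms] in auto)

text \<open>Endomorphisms of the whole algebraic closure over \<open>K\<close> stand in for its
  Galois group; on a Galois subfield they restrict to automorphisms by
  \<open>endos_restrict\<close>.\<close>

definition (in algebraic_closure) endos :: "('a \<Rightarrow> 'a) set" where
  "endos = {\<tau> \<in> ring_hom L L. \<forall>k\<in>K. \<tau> k = k}"

lemma (in algebraic_closure) endos_hom:
  assumes "\<tau> \<in> endos"
  shows "ring_hom_ring L L \<tau>"
  using assms ring_hom_ringI2[OF ring_axioms ring_axioms] unfolding endos_def by simp

lemma (in algebraic_closure) endos_root: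
  assumes "\<tau> \<in> endos" "p \<in> carrier (K[X])" "is_root p x"
  shows "is_root p (\<tau> x)"
proof -
  interpret T: ring_hom_ring L L \<tau>
    using endos_hom[OF assms(1)] .
  have "set p \<subseteq> K"
    using assms(2) by (simp add: univ_poly_carrier[symmetric] polynomial_incl)
  hence "map \<tau> p = p"
    using assms(1) unfolding endos_def by (simp add: map_idI subset_iff)
  moreover have "\<tau> (eval p x) = eval (map \<tau> p) (\<tau> x)"
    using T.eval_hom[OF subfieldE(1)[OF subfield_axioms] _ assms(2), of x] assms(3)
    unfolding is_root_def by blast
  ultimately show ?thesis
    using assms(3) unfolding is_root_def by simp
qed

text \<open>A conjugate \<open>y\<close> defines an embedding of \<open>simple_extension K x\<close>
  sending \<open>x\<close> to \<open>y\<close>, and \<open>hom_extend\<close> continues it to the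
  closure.\<close>

lemma (in algebraic_closure) exists_endo:
  assumes "x \<in> carrier L" "is_root (Irr K x) y"
  obtains \<tau> where "\<tau> \<in> endos" "\<tau> x = y"
proof -
  note sf = subfield_axioms
  have y: "y \<in> carrier L" "eval (map id (Irr K x)) y = \<zero>"
    using assms(2) unfolding is_root_def by auto
  have id: "id \<in> ring_hom (L\<lparr>carrier := K\<rparr>) L"
    using subfieldE(3)[OF sf] by (auto intro!: ring_hom_memI)
  let ?S = "simple_extension K x"
  have alg: "(algebraic over K) x"
    using algebraic_extension[OF assms(1)] .
  obtain t where t: "t \<in> ring_hom (L\<lparr>carrier := ?S\<rparr>) L" "\<And>e. e \<in> K \<Longrightarrow> t e = id e" "t x = y"
    by (rule hom_extend_simple[OF sf id assms(1) alg y]) blast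
  have S: "subfield ?S L" "K \<subseteq> ?S" "x \<in> ?S"
    using simple_extension_is_subfield[OF sf assms(1)] alg
      simple_extension_incl[OF subfieldE(3)[OF sf] assms(1)]
      simple_extension_mem[OF subfieldE(1)[OF sf] assms(1)] by auto
  obtain t' where t': "t' \<in> ring_hom L L" "\<And>e. e \<in> ?S \<Longrightarrow> t' e = t e"
    by (rule hom_extend[OF S(1,2) t(1)]) blast
  show thesis
    by (rule that[of t']) (use t' t S in \<open>auto simp: endos_def subset_iff\<close>)
qed

lemma (in algebraic_closure) Irr_K:
  assumes "x \<in> carrier L"
  shows "Irr K x \<in> carrier (K[X])" "Irr K x \<in> carrier (poly_ring L)" "is_root (Irr K x) x"
    "lead_coeff (Irr K x) = \<one>" "degree (Irr K x) \<ge> 1"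
proof -
  note I = IrrE[OF subfield_axioms assms algebraic_extension[OF assms]]
  show "Irr K x \<in> carrier (K[X])" "lead_coeff (Irr K x) = \<one>"
    using I by simp_all
  show deg: "degree (Irr K x) \<ge> 1"
    using pirreducible_degree[OF subfield_axioms I(1,2)] .
  show "Irr K x \<in> carrier (poly_ring L)"
    using carrier_polynomial_shell[OF subfieldE(1)[OF subfield_axioms] I(1)] .
  show "is_root (Irr K x) x"
    using I(4) assms deg unfolding is_root_def by auto
qed

text \<open>All roots of \<open>Irr K x\<close> are images of \<open>x\<close> under endomorphisms,
  so \<open>x\<close> is the only root. If the degree is n, the coefficient below the leading one is
  -n x and lies in \<open>K\<close>; dividing by n, which is nonzero in characteristic zero, puts
  \<open>x\<close> into \<open>K\<close>.\<close>

lemma (in algebraic_closure) fixed_by_endos: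
  assumes char0: "char_zero_ring (L\<lparr>carrier := K\<rparr>)"
    and x: "x \<in> carrier L" and fixed: "\<And>\<tau>. \<tau> \<in> endos \<Longrightarrow> \<tau> x = x"
  shows "x \<in> K"
proof -
  let ?p = "Irr K x" let ?n = "degree (Irr K x)"
  note I = Irr_K[OF x]
  have "y = x" if y: "is_root ?p y" for y
  proof -
    obtain \<tau> where "\<tau> \<in> endos" "\<tau> x = y"
      by (rule exists_endo[OF x y])
    thus ?thesis
      using fixed[of \<tau>] by simp
  qed
  hence "set_mset (roots ?p) \<subseteq> {x}"
    using roots_mem_iff_is_root[OF I(2)] by blast
  hence "roots ?p = replicate_mset (size (roots ?p)) x"
    by (rule set_mset_subset_singletonD)
  hence rts: "roots ?p = replicate_mset ?n x"
    using roots_over_carrier[OF I(2)] unfolding splitted_def by simp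
  have "?p \<noteq> []"
    using I(3) unfolding is_root_def by simp
  hence "coeff ?p (?n - 1) = \<ominus> (add_pow L ?n x \<otimes> lead_coeff ?p)"
    using coeff_single_root[OF I(2) _ x rts HOL.refl] I(5) by (simp split: if_splits)
  moreover have "coeff ?p (?n - 1) \<in> K"
    using coeff_in_subring[OF subfieldE(1)[OF subfield_axioms], of ?p] I(1)
    by (simp add: univ_poly_carrier[symmetric] polynomial_incl)
  ultimately have "\<ominus> (add_pow L ?n x) \<in> K"
    using I(4) x by simp
  hence "\<ominus> (\<ominus> (add_pow L ?n x)) \<in> K"
    using subringE(5)[OF subfieldE(1)[OF subfield_axioms]] by blast
  hence nx: "add_pow L ?n x \<in> K"
    using x by simp
  let ?k = "add_pow L ?n \<one>"
  have k: "?k \<in> K - {\<zero>}"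
  proof -
    have "?k = add_pow (L\<lparr>carrier := K\<rparr>) ?n \<one>\<^bsub>L\<lparr>carrier := K\<rparr>\<^esub>"
      by (simp add: add_pow_def nat_pow_def)
    thus ?thesis
      using add_pow_one_in_subring[OF subfieldE(1)[OF subfield_axioms], of ?n] char0 I(5)
      unfolding char_zero_ring_def by auto
  qed
  have kc: "?k \<in> carrier L" "?k \<noteq> \<zero>"
    using k subfieldE(3)[OF subfield_axioms] by auto
  have "?k \<otimes> x = add_pow L ?n x"
    using add_pow_ldistr[of \<one> x ?n] x by simp
  moreover have "x = inv ?k \<otimes> (?k \<otimes> x)"
    using x kc field_Units m_assoc[of "inv ?k" ?k x] by simp
  moreover have "inv ?k \<in> K"
    using subfield_m_inv(1)[OF subfield_axioms k] by simp
  ultimately show ?thesis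
    using nx subringE(6)[OF subfieldE(1)[OF subfield_axioms]] by metis
qed

text \<open>The witness polynomial is \<open>Irr K x\<close>: each of its roots is the image of
  \<open>x\<close> under an endomorphism, so stability puts it into \<open>E\<close>.\<close>

lemma (in algebraic_closure) galois_overI:
  assumes "subfield E L" "K \<subseteq> E" and stable: "\<And>\<tau> x. \<tau> \<in> endos \<Longrightarrow> x \<in> E \<Longrightarrow> \<tau> x \<in> E"
  shows "galois_over L K E"
  unfolding galois_over_def
proof (intro conjI ballI)
  fix x assume "x \<in> E"
  hence x: "x \<in> carrier L"
    using subfieldE(3)[OF assms(1)] by blast
  have "y \<in> E" if y: "is_root (Irr K x) y" for y
  proof -
    obtain \<tau> where "\<tau> \<in> endos" "\<tau> x = y"
      by (rule exists_endo[OF x y])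
    thus ?thesis
      using stable \<open>x \<in> E\<close> by blast
  qed
  thus "\<exists>p\<in>carrier (K[X]). is_root p x \<and> (\<forall>y. is_root p y \<longrightarrow> y \<in> E)"
    using Irr_K[OF x] by blast
qed (use assms in auto)

lemma (in algebraic_closure) galois_over_stable:
  assumes "galois_over L K E" "\<tau> \<in> endos" "x \<in> E"
  shows "\<tau> x \<in> E"
  using assms endos_root unfolding galois_over_def by blast

text \<open>Injectivity is automatic for field homomorphisms. Surjectivity onto \<open>E\<close>
  holds because an injective \<open>\<tau>\<close> permutes the finite root set of a polynomial over
  \<open>K\<close>, and for \<open>x\<close> in \<open>E\<close> that root set can be taken inside
  \<open>E\<close>.\<close>

lemma (in algebraic_closure) endos_restrict:
  assumes gal: "galois_over L K E" and t: "\<tau> \<in> endos"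
  shows "restrict \<tau> E \<in> carrier (galois_group L K E)"
proof -
  interpret T: ring_hom_ring L L \<tau>
    using endos_hom[OF t] .
  have E: "subfield E L" "K \<subseteq> E"
    using gal unfolding galois_over_def by auto
  note EL = subfieldE(3)[OF E(1)]
  have inj: "inj_on \<tau> (carrier L)"
    using non_trivial_field_hom_is_inj[OF T.homh field_axioms field_axioms] .
  have "\<tau> ` E = E"
  proof
    show "\<tau> ` E \<subseteq> E"
      using galois_over_stable[OF gal t] by blast
    show "E \<subseteq> \<tau> ` E"
    proof
      fix x assume "x \<in> E"
      then obtain p where p: "p \<in> carrier (K[X])" "is_root p x" "\<And>y. is_root p y \<Longrightarrow> y \<in> E"
        using gal unfolding galois_over_def by blast
      let ?R = "{y. is_root p y}"
      have "finite ?R"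
        using finite_number_of_roots carrier_polynomial_shell[OF subfieldE(1)[OF subfield_axioms] p(1)] by blast
      moreover have "\<tau> ` ?R \<subseteq> ?R"
        using endos_root[OF t p(1)] by blast
      moreover have "inj_on \<tau> ?R"
        by (rule inj_on_subset[OF inj]) (auto simp: is_root_def)
      ultimately have "\<tau> ` ?R = ?R"
        by (rule endo_inj_surj)
      thus "x \<in> \<tau> ` E"
        using p(2,3) by blast
    qed
  qed
  hence "restrict \<tau> E \<in> Bij E"
    using inj_on_subset[OF inj EL] unfolding Bij_def bij_betw_def by (auto simp: inj_on_def)
  moreover have "restrict \<tau> E \<in> ring_hom (L\<lparr>carrier := E\<rparr>) (L\<lparr>carrier := E\<rparr>)"
    using galois_over_stable[OF gal t] EL subringE(3,6,7)[OF subfieldE(1)[OF E(1)]] T.hom_add T.hom_mult T.hom_one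
    by (auto intro!: ring_hom_memI simp: subset_iff)
  ultimately show ?thesis
    using t E(2) unfolding galois_group_def endos_def by auto
qed

section \<open>The fields F2 and F3\<close>

context algebraic_closure
begin

lemma endos_generate_field:
  assumes t: "\<tau> \<in> endos" and H: "H \<subseteq> carrier L"
    and gen: "\<And>h. h \<in> H \<Longrightarrow> \<tau> h \<in> generate_field L H'" and H': "H' \<subseteq> carrier L"
    and x: "x \<in> generate_field L H"
  shows "\<tau> x \<in> generate_field L H'"
proof -
  interpret T: ring_hom_ring L L \<tau>
    using endos_hom[OF t] .
  have inj: "inj_on \<tau> (carrier L)"
    using non_trivial_field_hom_is_inj[OF T.homh field_axioms field_axioms] .
  \<comment> \<open>Membership in the carrier is carried along because the inverse case uses
    injectivity of \<open>\<tau>\<close> there.\<close>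
  have "x \<in> carrier L \<and> \<tau> x \<in> generate_field L H'"
    using x
  proof (induction rule: generate_field.induct)
    case (m_inv h)
    hence h: "h \<in> carrier L" "h \<noteq> \<zero>" "\<tau> h \<in> generate_field L H'"
      by auto
    hence ih: "inv h \<in> carrier L" "h \<otimes> inv h = \<one>"
      using field_Units by auto
    have "\<tau> h \<noteq> \<zero>"
      using inj_onD[OF inj, of h \<zero>] h T.hom_zero by auto
    moreover have "\<tau> h \<otimes> \<tau> (inv h) = \<one>"
      using T.hom_mult[OF h(1) ih(1)] ih(2) T.hom_one by simp
    ultimately have "\<tau> (inv h) = inv (\<tau> h)"
      using comm_inv_char[of "\<tau> h" "\<tau> (inv h)"] h(1) ih(1) T.hom_closed by simp
    thus ?case
      using ih(1) generate_field.m_inv[OF h(3) \<open>\<tau> h \<noteq> \<zero>\<close>] by simp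
  qed (use H gen in \<open>auto simp: subset_iff intro: generate_field.intros\<close>)
  thus ?thesis ..
qed

lemma endos_square:
  assumes "\<tau> \<in> endos" "x \<in> carrier L"
  shows "\<tau> x \<in> carrier L" "\<tau> x \<otimes> \<tau> x = \<tau> (x \<otimes> x)"
  using assms unfolding endos_def ring_hom_def by auto

lemma F2_props:
  shows "subfield (F2 L K) L" "K \<subseteq> F2 L K"
    and "\<And>x. \<lbrakk> x \<in> carrier L; x \<otimes> x \<in> K \<rbrakk> \<Longrightarrow> x \<in> F2 L K"
    and "\<And>\<tau> x. \<lbrakk> \<tau> \<in> endos; x \<in> F2 L K \<rbrakk> \<Longrightarrow> \<tau> x \<in> F2 L K"
proof -
  let ?H = "K \<union> {x \<in> carrier L. x \<otimes> x \<in> K}"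
  have H: "?H \<subseteq> carrier L"
    using subfieldE(3)[OF subfield_axioms] by auto
  show "subfield (F2 L K) L"
    unfolding F2_def using generate_field_is_subfield[OF H] .
  show "K \<subseteq> F2 L K"
    unfolding F2_def by (auto intro: generate_field.incl)
  show "x \<in> F2 L K" if "x \<in> carrier L" "x \<otimes> x \<in> K" for x
    unfolding F2_def using that by (auto intro: generate_field.incl)
  show "\<tau> x \<in> F2 L K" if t: "\<tau> \<in> endos" and x: "x \<in> F2 L K" for \<tau> x
    unfolding F2_def
  proof (rule endos_generate_field[OF t H _ H])
    show "x \<in> generate_field L ?H"
      using x unfolding F2_def .
    fix h assume "h \<in> ?H"
    hence "\<tau> h \<in> ?H"
      using endos_square[OF t, of h] t unfolding endos_def by auto
    thus "\<tau> h \<in> generate_field L ?H"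
      by (rule generate_field.incl)
  qed
qed

text \<open>The last claim is the working criterion for membership: its hypothesis makes the field
  generated by \<open>x\<close> over \<open>F2 L K\<close> stable under all endomorphisms, hence
  Galois over \<open>K\<close>.\<close>

lemma F3_props:
  shows "subfield (F3 L K) L" "F2 L K \<subseteq> F3 L K" "galois_over L K (F3 L K)"
    and "\<And>x. \<lbrakk> x \<in> carrier L; x \<otimes> x \<in> F2 L K;
        \<And>\<tau>. \<tau> \<in> endos \<Longrightarrow> \<tau> x \<in> generate_field L (F2 L K \<union> {x}) \<rbrakk> \<Longrightarrow> x \<in> F3 L K"
proof -
  define N where "N = {x \<in> carrier L. x \<otimes> x \<in> F2 L K \<and>
    galois_over L K (generate_field L (F2 L K \<union> {x}))}"
  have F3: "F3 L K = generate_field L (F2 L K \<union> N)"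
    unfolding F3_def N_def ..
  have F2L: "F2 L K \<subseteq> carrier L"
    using subfieldE(3)[OF F2_props(1)] .
  have H: "F2 L K \<union> N \<subseteq> carrier L"
    using F2L unfolding N_def by auto
  show sf: "subfield (F3 L K) L"
    unfolding F3 using generate_field_is_subfield[OF H] .
  show F23: "F2 L K \<subseteq> F3 L K"
    unfolding F3 by (auto intro: generate_field.incl)
  show "galois_over L K (F3 L K)"
  proof (rule galois_overI[OF sf])
    show "K \<subseteq> F3 L K"
      using F23 F2_props(2) by blast
    fix \<tau> x assume t: "\<tau> \<in> endos" and x: "x \<in> F3 L K"
    show "\<tau> x \<in> F3 L K"
      unfolding F3
    proof (rule endos_generate_field[OF t H _ H x[unfolded F3]])
      fix h assume h: "h \<in> F2 L K \<union> N"
      show "\<tau> h \<in> generate_field L (F2 L K \<union> N)"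
      proof (cases "h \<in> F2 L K")
        case True
        thus ?thesis
          using F2_props(4)[OF t] by (auto intro: generate_field.incl)
      next
        case False
        hence hN: "h \<in> N"
          using h by simp
        have "h \<in> generate_field L (F2 L K \<union> {h})"
          by (rule generate_field.incl) simp
        moreover have "galois_over L K (generate_field L (F2 L K \<union> {h}))"
          using hN unfolding N_def by blast
        ultimately have "\<tau> h \<in> generate_field L (F2 L K \<union> {h})"
          using galois_over_stable[OF _ t] by blast
        moreover have "generate_field L (F2 L K \<union> {h}) \<subseteq> generate_field L (F2 L K \<union> N)"
          using mono_generate_field[OF _ H] hN by auto
        ultimately show ?thesis
          by blast
      qed
    qed
  qed
  fix x assume x: "x \<in> carrier L" "x \<otimes> x \<in> F2 L K"
    and st: "\<And>\<tau>. \<tau> \<in> endos \<Longrightarrow> \<tau> x \<in> generate_field L (F2 L K \<union> {x})"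
  let ?H = "F2 L K \<union> {x}"
  have H': "?H \<subseteq> carrier L"
    using F2L x(1) by auto
  have "galois_over L K (generate_field L ?H)"
  proof (rule galois_overI)
    show "subfield (generate_field L ?H) L"
      using generate_field_is_subfield[OF H'] .
    show "K \<subseteq> generate_field L ?H"
      using F2_props(2) by (auto intro: generate_field.incl)
    fix \<tau> y assume t: "\<tau> \<in> endos" and y: "y \<in> generate_field L ?H"
    show "\<tau> y \<in> generate_field L ?H"
    proof (rule endos_generate_field[OF t H' _ H' y])
      fix h assume "h \<in> ?H"
      thus "\<tau> h \<in> generate_field L ?H"
        using st[OF t] F2_props(4)[OF t] by (auto intro: generate_field.incl)
    qed
  qed
  hence "x \<in> N"
    using x unfolding N_def by simp
  thus "x \<in> F3 L K"
    unfolding F3 by (auto intro: generate_field.incl)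
qed

text \<open>An endomorphism fixes or negates \<alpha>. In the first case it sends \<omega> to
  \<omega> or its negative. In the second, (x + y\<alpha>)(x - y\<alpha>) = \<beta>^2 makes the
  product of \<omega> and its image equal to \<beta> or its negative. As \<beta> lies in
  \<open>F2 L K\<close>, all conjugates of \<omega> stay in the field that \<omega> generates over
  it.\<close>

lemma square_root_norm_in_F3:
  assumes xy: "x \<in> K" "y \<in> K" and a: "\<alpha> \<in> carrier L" "\<alpha> \<otimes> \<alpha> \<in> K"
    and b: "\<beta> \<in> carrier L" "\<beta> \<noteq> \<zero>" "\<beta> \<otimes> \<beta> = x \<otimes> x \<ominus> (\<alpha> \<otimes> \<alpha>) \<otimes> (y \<otimes> y)"
    and w: "\<omega> \<in> carrier L" "\<omega> \<otimes> \<omega> = x \<oplus> y \<otimes> \<alpha>"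
  shows "\<omega> \<in> F3 L K"
proof (rule F3_props(4)[OF w(1)])
  note sf = F2_props(1)
  note KL = subfieldE(3)[OF subfield_axioms]
  have xyL: "x \<in> carrier L" "y \<in> carrier L"
    using xy KL by auto
  have "\<beta> \<otimes> \<beta> \<in> K"
    unfolding b(3) a_minus_def using xy a subringE(5-7)[OF subfieldE(1)[OF subfield_axioms]] by simp
  hence bF: "\<beta> \<in> F2 L K"
    using F2_props(3) b(1) by blast
  have aF: "\<alpha> \<in> F2 L K"
    using F2_props(3) a by blast
  have xyF: "x \<in> F2 L K" "y \<in> F2 L K"
    using xy F2_props(2) by auto
  show "\<omega> \<otimes> \<omega> \<in> F2 L K"
    unfolding w(2) using xyF aF subringE(6,7)[OF subfieldE(1)[OF sf]] by blast
  let ?E = "generate_field L (F2 L K \<union> {\<omega>})"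
  have E: "subfield ?E L"
    using generate_field_is_subfield[of "F2 L K \<union> {\<omega>}"] subfieldE(3)[OF sf] w(1) by simp
  have wE: "\<omega> \<in> ?E" and bE: "\<beta> \<in> ?E"
    using bF by (auto intro: generate_field.incl)
  have norm: "(x \<oplus> y \<otimes> \<alpha>) \<otimes> (x \<oplus> y \<otimes> (\<ominus> \<alpha>)) = \<beta> \<otimes> \<beta>"
    unfolding b(3) using xyL a(1) by algebra
  have "\<omega> \<noteq> \<zero>"
    using norm[folded w(2)] b(1,2) xyL a(1) integral_iff[of \<beta> \<beta>] by auto
  hence iw: "inv \<omega> \<in> ?E" "inv \<omega> \<in> carrier L" "\<omega> \<otimes> inv \<omega> = \<one>"
    using subfield_m_inv[OF E] wE subfieldE(3)[OF E] by auto
  fix \<tau> assume t: "\<tau> \<in> endos"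
  interpret T: ring_hom_ring L L \<tau>
    using endos_hom[OF t] .
  have fixK: "\<tau> k = k" if "k \<in> K" for k
    using t that unfolding endos_def by blast
  have sq: "\<tau> \<omega> \<otimes> \<tau> \<omega> = x \<oplus> y \<otimes> \<tau> \<alpha>"
    using endos_square(2)[OF t w(1)] w(2) xyL a(1) fixK xy by simp
  have "\<tau> \<alpha> \<otimes> \<tau> \<alpha> = \<alpha> \<otimes> \<alpha>"
    using endos_square(2)[OF t a(1)] fixK[OF a(2)] by simp
  hence "\<tau> \<alpha> = \<alpha> \<or> \<tau> \<alpha> = \<ominus> \<alpha>"
    using square_eq_iff[of "\<tau> \<alpha>" \<alpha>] a(1) T.hom_closed by simp
  thus "\<tau> \<omega> \<in> ?E"
  proof
    assume "\<tau> \<alpha> = \<alpha>"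
    hence "\<tau> \<omega> \<otimes> \<tau> \<omega> = \<omega> \<otimes> \<omega>"
      using sq w(2) by simp
    thus ?thesis
      using square_root_subfield[OF E _ wE] T.hom_closed[OF w(1)] by blast
  next
    assume "\<tau> \<alpha> = \<ominus> \<alpha>"
    hence *: "(\<omega> \<otimes> \<omega>) \<otimes> (\<tau> \<omega> \<otimes> \<tau> \<omega>) = \<beta> \<otimes> \<beta>"
      using sq w(2) norm by simp
    have tw: "\<tau> \<omega> \<in> carrier L"
      using T.hom_closed[OF w(1)] .
    have "(\<omega> \<otimes> \<tau> \<omega>) \<otimes> (\<omega> \<otimes> \<tau> \<omega>) = \<beta> \<otimes> \<beta>"
      unfolding *[symmetric] using tw w(1) by algebra
    hence "\<omega> \<otimes> \<tau> \<omega> \<in> ?E"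
      using square_root_subfield[OF E _ bE] tw w(1) by blast
    hence "inv \<omega> \<otimes> (\<omega> \<otimes> \<tau> \<omega>) \<in> ?E"
      using iw(1) subringE(6)[OF subfieldE(1)[OF E]] by blast
    moreover have "inv \<omega> \<otimes> (\<omega> \<otimes> \<tau> \<omega>) = \<tau> \<omega>"
      using iw(2,3) tw w(1) by (simp add: m_assoc[symmetric] m_comm)
    ultimately show ?thesis
      by simp
  qed
qed

text \<open>Endomorphisms restrict to elements of the W-group, so what the W-group fixes is fixed by
  all endomorphisms.\<close>

lemma W_group_fixed:
  assumes "char_zero_ring (L\<lparr>carrier := K\<rparr>)" "x \<in> F3 L K"
    and "\<And>\<sigma>. \<sigma> \<in> carrier (W_group L K) \<Longrightarrow> \<sigma> x = x"
  shows "x \<in> K"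
proof (rule fixed_by_endos[OF assms(1)])
  show "x \<in> carrier L"
    using assms(2) subfieldE(3)[OF F3_props(1)] by blast
  fix \<tau> assume "\<tau> \<in> endos"
  hence "restrict \<tau> (F3 L K) x = x"
    using endos_restrict[OF F3_props(3)] assms(3) unfolding W_group_def by blast
  thus "\<tau> x = x"
    using assms(2) by simp
qed

end

section \<open>The group W5\<close>

text \<open>The commutator of \<open>x\<close> and \<open>y\<close> equals (xy)^2 x^(-2) y^(-2), a
  product of three central squares.\<close>

lemma (in group) squares_central_commutator:
  assumes central: "\<And>x y. x \<in> carrier G \<Longrightarrow> y \<in> carrier G \<Longrightarrow> x \<otimes> x \<otimes> y = y \<otimes> (x \<otimes> x)"
    and "x \<in> carrier G" "y \<in> carrier G" "z \<in> carrier G"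
  shows "(x \<otimes> y \<otimes> inv x \<otimes> inv y) \<otimes> z = z \<otimes> (x \<otimes> y \<otimes> inv x \<otimes> inv y)"
proof -
  let ?a = "(x \<otimes> y) \<otimes> (x \<otimes> y)" and ?b = "inv x \<otimes> inv x" and ?c = "inv y \<otimes> inv y"
  have cl: "x \<otimes> y \<in> carrier G" "inv x \<in> carrier G" "inv y \<in> carrier G"
    using assms by auto
  have "?a \<otimes> ?b \<otimes> ?c = x \<otimes> y \<otimes> (x \<otimes> y \<otimes> ?b) \<otimes> ?c"
    using assms(2,3) by (simp add: m_assoc)
  also have "\<dots> = x \<otimes> y \<otimes> (?b \<otimes> (x \<otimes> y)) \<otimes> ?c"
    using central[OF cl(2,1)] by simp
  also have "\<dots> = x \<otimes> y \<otimes> inv x \<otimes> inv y"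
    using assms(2,3) inv_solve_left' by (simp add: m_assoc[symmetric] inv_mult_group)
      (simp add: m_assoc)
  finally have eq: "x \<otimes> y \<otimes> inv x \<otimes> inv y = ?a \<otimes> ?b \<otimes> ?c" ..
  have "?a \<otimes> ?b \<otimes> ?c \<otimes> z = ?a \<otimes> (?b \<otimes> (?c \<otimes> z))"
    using assms(2-4) by (simp add: m_assoc)
  also have "\<dots> = ?a \<otimes> (?b \<otimes> (z \<otimes> ?c))"
    using central[OF cl(3) assms(4)] by simp
  also have "\<dots> = ?a \<otimes> (?b \<otimes> z \<otimes> ?c)"
    using assms(2-4) by (simp add: m_assoc)
  also have "\<dots> = ?a \<otimes> z \<otimes> ?b \<otimes> ?c"
    using central[OF cl(2) assms(4)] assms(2-4) by (simp add: m_assoc)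
  also have "\<dots> = z \<otimes> (?a \<otimes> ?b \<otimes> ?c)"
    using central[OF cl(1) assms(4)] assms(2-4) by (simp add: m_assoc)
  finally show ?thesis
    unfolding eq .
qed

text \<open>The commutator \<open>c h\<close> of \<open>s\<close> and \<open>h\<close> is central
  and multiplicative in \<open>h\<close>. Hence words in \<open>H\<close> and \<open>s\<close> can
  be collected into the form h s^e [s, k] with h and k in \<open>H\<close>, and there are finitely
  many such forms.\<close>

lemma (in group) finite_mult_closed_insert_involution:
  assumes central: "\<And>x y. x \<in> carrier G \<Longrightarrow> y \<in> carrier G \<Longrightarrow> x \<otimes> x \<otimes> y = y \<otimes> (x \<otimes> x)"
    and H: "finite H" "H \<subseteq> carrier G" "\<one> \<in> H" "\<And>x y. x \<in> H \<Longrightarrow> y \<in> H \<Longrightarrow> x \<otimes> y \<in> H"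
    and s: "s \<in> carrier G" "s \<otimes> s = \<one>"
  obtains H' where "finite H'" "H' \<subseteq> carrier G" "H \<subseteq> H'" "s \<in> H'"
    "\<And>x y. x \<in> H' \<Longrightarrow> y \<in> H' \<Longrightarrow> x \<otimes> y \<in> H'"
proof -
  define c where "c h = s \<otimes> h \<otimes> inv s \<otimes> inv h" for h
  define H' where "H' = (\<lambda>(h, e, d). h \<otimes> (e \<otimes> d)) ` (H \<times> {\<one>, s} \<times> c ` H)"
  have HC: "h \<in> carrier G" if "h \<in> H" for h
    using that H(2) by blast
  have cC: "c h \<in> carrier G" if "h \<in> carrier G" for h
    unfolding c_def using that s(1) by simp
  have cz: "c h \<otimes> z = z \<otimes> c h" if "h \<in> carrier G" "z \<in> carrier G" for h z
    unfolding c_def using squares_central_commutator[OF central s(1) that] .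
  have c1: "c \<one> = \<one>"
    unfolding c_def using s(1) by simp
  \<comment> \<open>Moving \<open>s\<close> to the right past \<open>h\<close> costs the central
    factor \<open>c h\<close>.\<close>
  have swap: "s \<otimes> h = h \<otimes> (s \<otimes> c h)" if h: "h \<in> carrier G" for h
  proof -
    have "s \<otimes> h = c h \<otimes> (h \<otimes> s)"
      unfolding c_def using h s(1) m_assoc[of "inv h" h s, symmetric] by (simp add: m_assoc)
    also have "\<dots> = h \<otimes> s \<otimes> c h"
      using cz[OF h] h s(1) by simp
    finally show ?thesis
      using h s(1) cC[OF h] by (simp add: m_assoc)
  qed
  have cm: "c h \<otimes> c k = c (h \<otimes> k)" if hk: "h \<in> carrier G" "k \<in> carrier G" for h k
  proof -
    have "c (h \<otimes> k) = s \<otimes> h \<otimes> (k \<otimes> inv s \<otimes> inv k) \<otimes> inv h"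
      unfolding c_def using hk s(1) by (simp add: m_assoc inv_mult_group)
    also have "k \<otimes> inv s \<otimes> inv k = inv s \<otimes> c k"
      unfolding c_def using hk s(1) by (simp add: m_assoc[symmetric])
    also have "s \<otimes> h \<otimes> (inv s \<otimes> c k) \<otimes> inv h = s \<otimes> h \<otimes> inv s \<otimes> (c k \<otimes> inv h)"
      using hk s(1) cC by (simp add: m_assoc)
    also have "c k \<otimes> inv h = inv h \<otimes> c k"
      using cz hk by simp
    finally show ?thesis
      unfolding c_def[of h] using hk s(1) cC by (simp add: m_assoc)
  qed
  have "finite H'"
    unfolding H'_def using H(1) by simp
  moreover have "H' \<subseteq> carrier G"
    unfolding H'_def using HC cC s(1) by auto
  moreover have "H \<subseteq> H'"
  proof
    fix h assume "h \<in> H"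
    hence "h = h \<otimes> (\<one> \<otimes> c \<one>)"
      using HC c1 by simp
    thus "h \<in> H'"
      unfolding H'_def using \<open>h \<in> H\<close> H(3) by force
  qed
  moreover have "s \<in> H'"
  proof -
    have "s = \<one> \<otimes> (s \<otimes> c \<one>)"
      using s(1) c1 by simp
    thus ?thesis
      unfolding H'_def using H(3) by force
  qed
  moreover have "x \<otimes> y \<in> H'" if xH: "x \<in> H'" and yH: "y \<in> H'" for x y
  proof -
    obtain h e k where x: "h \<in> H" "e \<in> {\<one>, s}" "k \<in> H" "x = h \<otimes> (e \<otimes> c k)"
      using xH unfolding H'_def by auto
    obtain h' e' k' where y: "h' \<in> H" "e' \<in> {\<one>, s}" "k' \<in> H" "y = h' \<otimes> (e' \<otimes> c k')"
      using yH unfolding H'_def by auto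
    note C = HC[OF x(1)] HC[OF x(3)] HC[OF y(1)] HC[OF y(3)]
    have eC: "e \<in> carrier G" "e' \<in> carrier G"
      using x(2) y(2) s(1) by auto
    \<comment> \<open>If \<open>e\<close> is the identity, nothing is moved and \<open>m\<close> is
      the identity; if \<open>e\<close> is \<open>s\<close>, the collected commutator is
      \<open>c h'\<close>, so \<open>m\<close> is \<open>h'\<close>.\<close>
    obtain m where m: "m \<in> H" "e \<otimes> h' = h' \<otimes> (e \<otimes> c m)"
    proof (cases "e = \<one>")
      case True
      thus thesis
        using that[of \<one>] c1 H(3) C(3) by simp
    next
      case False
      thus thesis
        using that[of h'] x(2) swap[OF C(3)] y(1) by simp
    qed
    note mC = HC[OF m(1)]
    have "x \<otimes> y = h \<otimes> (e \<otimes> (c k \<otimes> h') \<otimes> (e' \<otimes> c k'))"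
      unfolding x y using C eC cC by (simp add: m_assoc)
    also have "\<dots> = h \<otimes> ((e \<otimes> h') \<otimes> (c k \<otimes> e') \<otimes> c k')"
      using cz[OF C(2,3)] C eC cC by (simp add: m_assoc)
    also have "\<dots> = h \<otimes> (h' \<otimes> (e \<otimes> (c m \<otimes> e') \<otimes> (c k \<otimes> c k')))"
      using cz[OF C(2) eC(2)] m(2) C eC cC mC by (simp add: m_assoc)
    also have "\<dots> = (h \<otimes> h') \<otimes> ((e \<otimes> e') \<otimes> (c m \<otimes> (c k \<otimes> c k')))"
      using cz[OF mC eC(2)] C eC cC mC by (simp add: m_assoc)
    also have "c m \<otimes> (c k \<otimes> c k') = c (m \<otimes> (k \<otimes> k'))"
      using cm C mC by simp
    finally have eq: "x \<otimes> y = (h \<otimes> h') \<otimes> ((e \<otimes> e') \<otimes> c (m \<otimes> (k \<otimes> k')))" .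
    have "e \<otimes> e' \<in> {\<one>, s}"
      using x(2) y(2) s by auto
    moreover have "h \<otimes> h' \<in> H" "m \<otimes> (k \<otimes> k') \<in> H"
      using H(4) x y m by auto
    ultimately show ?thesis
      unfolding eq H'_def by (intro image_eqI[where x = "(h \<otimes> h', e \<otimes> e', c (m \<otimes> (k \<otimes> k')))"]) auto
  qed
  ultimately show thesis
    using that by blast
qed

section \<open>Words in five letters and their finite quotient group\<close>

lemma letters5_append [simp]: "u @ v \<in> letters5 \<longleftrightarrow> u \<in> letters5 \<and> v \<in> letters5"
  and letters5_Nil [simp]: "[] \<in> letters5"
  and letters5_Cons [simp]: "i # v \<in> letters5 \<longleftrightarrow> i < 5 \<and> v \<in> letters5"
  by (auto simp: letters5_def)

lemma wrel_letters5: "wrel u v \<Longrightarrow> u \<in> letters5 \<and> v \<in> letters5"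
  by (induction rule: wrel.induct) auto

lemma wclass_eq_iff:
  assumes "u \<in> letters5" "v \<in> letters5"
  shows "wclass u = wclass v \<longleftrightarrow> wrel u v"
  using assms unfolding wclass_def
  by (auto intro: wrel.refl wrel.sym wrel.trans)

text \<open>\<open>wrel\<close> is a congruence, so the representatives picked by
  \<open>SOME\<close> may be replaced by \<open>u\<close> and \<open>v\<close>.\<close>

lemma W5_mult:
  assumes "u \<in> letters5" "v \<in> letters5"
  shows "wclass u \<otimes>\<^bsub>W5\<^esub> wclass v = wclass (u @ v)"
proof -
  let ?x = "SOME x. x \<in> wclass u" and ?y = "SOME y. y \<in> wclass v"
  have "?x \<in> wclass u" "?y \<in> wclass v"
    using assms wrel.refl by (auto intro!: someI simp: wclass_def)
  hence "wrel (u @ v) (?x @ ?y)"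
    unfolding wclass_def by (auto intro: wrel.cong)
  hence "wclass (?x @ ?y) = wclass (u @ v)"
    using wclass_eq_iff wrel_letters5 by blast
  thus ?thesis
    unfolding W5_def by simp
qed

lemma W5_simps [simp]: "carrier W5 = wclass ` letters5" "\<one>\<^bsub>W5\<^esub> = wclass []"
  unfolding W5_def by simp_all

lemma group_W5: "group W5"
proof (rule groupI)
  fix x assume "x \<in> carrier W5"
  then obtain w where w: "w \<in> letters5" "x = wclass w" by auto
  have "wclass (w @ w @ w) \<otimes>\<^bsub>W5\<^esub> x = \<one>\<^bsub>W5\<^esub>"
    using w W5_mult[of "w @ w @ w" w] wclass_eq_iff[of "w @ w @ w @ w" "[]"] wrel.exp4 by simp
  thus "\<exists>y\<in>carrier W5. y \<otimes>\<^bsub>W5\<^esub> x = \<one>\<^bsub>W5\<^esub>"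
    using w(1) by (intro bexI[of _ "wclass (w @ w @ w)"]) auto
qed (auto simp: W5_mult)

text \<open>Finiteness makes sums over the group available. The generating involutions are adjoined
  one at a time to the trivial subgroup, and the multiplicatively closed set stays finite at each
  stage.\<close>

lemma finite_W5: "finite (carrier W5)"
proof -
  interpret group W5
    by (rule group_W5)
  have central: "x \<otimes>\<^bsub>W5\<^esub> x \<otimes>\<^bsub>W5\<^esub> y = y \<otimes>\<^bsub>W5\<^esub> (x \<otimes>\<^bsub>W5\<^esub> x)"
    if "x \<in> carrier W5" "y \<in> carrier W5" for x y
  proof -
    obtain u v where "u \<in> letters5" "v \<in> letters5" "x = wclass u" "y = wclass v"
      using \<open>x \<in> carrier W5\<close> \<open>y \<in> carrier W5\<close> by auto
    thus ?thesis
      using wrel.central[of u v] wclass_eq_iff[of "u @ u @ v" "v @ u @ u"] by (simp add: W5_mult)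
  qed
  have "\<exists>H. finite H \<and> H \<subseteq> carrier W5 \<and> \<one>\<^bsub>W5\<^esub> \<in> H \<and> (\<forall>i<k. wclass [i] \<in> H) \<and>
      (\<forall>x\<in>H. \<forall>y\<in>H. x \<otimes>\<^bsub>W5\<^esub> y \<in> H)" if "k \<le> 5" for k
    using that
  proof (induction k)
    case 0
    show ?case
      by (rule exI[of _ "{\<one>\<^bsub>W5\<^esub>}"]) (auto simp: W5_mult)
  next
    case (Suc k)
    obtain H where H: "finite H" "H \<subseteq> carrier W5" "\<one>\<^bsub>W5\<^esub> \<in> H" "\<forall>i<k. wclass [i] \<in> H"
      and "\<forall>x\<in>H. \<forall>y\<in>H. x \<otimes>\<^bsub>W5\<^esub> y \<in> H"
      using Suc.IH[OF Suc_leD[OF Suc.prems]] by blast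
    hence closed: "\<And>x y. x \<in> H \<Longrightarrow> y \<in> H \<Longrightarrow> x \<otimes>\<^bsub>W5\<^esub> y \<in> H"
      by blast
    have s: "wclass [k] \<in> carrier W5" "wclass [k] \<otimes>\<^bsub>W5\<^esub> wclass [k] = \<one>\<^bsub>W5\<^esub>"
      using Suc.prems wrel.invol[of k] by (auto simp: W5_mult wclass_eq_iff)
    obtain H' where H': "finite H'" "H' \<subseteq> carrier W5" "H \<subseteq> H'" "wclass [k] \<in> H'"
      "\<And>x y. x \<in> H' \<Longrightarrow> y \<in> H' \<Longrightarrow> x \<otimes>\<^bsub>W5\<^esub> y \<in> H'"
      by (rule finite_mult_closed_insert_involution[OF central H(1,2,3) closed s]) blast+
    thus ?case
      using H(3,4) by (intro exI[of _ H']) (auto simp: less_Suc_eq)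
  qed
  from this[of 5] obtain H where H: "finite H" "\<one>\<^bsub>W5\<^esub> \<in> H" "\<forall>i<5. wclass [i] \<in> H"
    "\<forall>x\<in>H. \<forall>y\<in>H. x \<otimes>\<^bsub>W5\<^esub> y \<in> H"
    by blast
  have "wclass w \<in> H" if "w \<in> letters5" for w
    using that
  proof (induction w)
    case (Cons i w)
    hence "wclass [i] \<otimes>\<^bsub>W5\<^esub> wclass w \<in> H"
      using H(3,4) by simp
    thus ?case
      using Cons.prems by (simp add: W5_mult)
  qed (use H(2) in simp)
  hence "carrier W5 \<subseteq> H"
    by auto
  thus ?thesis
    using H(1) finite_subset by blast
qed

text \<open>The Heisenberg group over the field with two elements, which is dihedral of order 8. A letter
  in \<open>T\<close> acts on a pair \<open>(w, w')\<close> by negating \<open>w'\<close>, a letter in \<open>S\<close> by exchanging \<open>w\<close> and \<open>w'\<close>.\<close>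

fun hmul :: "bool \<times> bool \<times> bool \<Rightarrow> bool \<times> bool \<times> bool \<Rightarrow> bool \<times> bool \<times> bool" where
  "hmul (a, b, c) (a', b', c') = ((a \<noteq> a') \<noteq> (b \<and> c'), b \<noteq> b', c \<noteq> c')"

fun heis :: "nat set \<Rightarrow> nat set \<Rightarrow> nat list \<Rightarrow> bool \<times> bool \<times> bool" where
  "heis S T [] = (False, False, False)"
| "heis S T (i # w) = hmul (False, i \<in> T, i \<in> S) (heis S T w)"

lemma hmul_assoc: "hmul (hmul x y) z = hmul x (hmul y z)"
  by (cases x; cases y; cases z) auto

lemma heis_append: "heis S T (u @ v) = hmul (heis S T u) (heis S T v)"
proof (induction u)
  case Nil
  show ?case by (cases "heis S T v") auto
qed (simp add: hmul_assoc)

text \<open>Fourth powers are trivial and squares are central in the dihedral group. A letter in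
  both \<open>S\<close> and \<open>T\<close> would have order four, so disjointness makes every
  letter an involution. The second hypothesis is the long relation.\<close>

lemma heis_wrel:
  assumes "S \<inter> T = {}" "heis S T ([0,1,2,3,4] @ [0,1,2,3,4]) = (False, False, False)"
    and "wrel u v"
  shows "heis S T u = heis S T v"
  using assms(3)
proof (induction rule: wrel.induct)
  case (exp4 w)
  show ?case
    by (cases "heis S T w") (auto simp: heis_append)
next
  case (central w v)
  show ?case
    by (cases "heis S T w"; cases "heis S T v") (auto simp: heis_append)
next
  case (invol i)
  show ?case
    using assms(1) by auto
next
  case prod
  show ?case
    using assms(2) by simp
qed (auto simp: heis_append)

section \<open>Eigenvectors of the W-group\<close>

text \<open>Choose \<open>u\<close> separating the characters \<open>i\<close> and \<open>j\<close>,
  and subtract \<open>\<chi> j u\<close> times the relation at z from the relation at uz. The terms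
  of index \<open>j\<close> cancel, and the induction hypothesis applies to the coefficients
  \<open>c k \<otimes> (\<chi> k u \<ominus> \<chi> j u)\<close>.\<close>

lemma (in field) dedekind_independence:
  fixes \<chi> :: "'i \<Rightarrow> 'a \<Rightarrow> 'a"
  assumes "finite A"
    and M: "\<one> \<in> M" "\<And>u v. u \<in> M \<Longrightarrow> v \<in> M \<Longrightarrow> u \<otimes> v \<in> M"
    and \<chi>: "\<And>i u. i \<in> A \<Longrightarrow> u \<in> M \<Longrightarrow> \<chi> i u \<in> carrier R" "\<And>i. i \<in> A \<Longrightarrow> \<chi> i \<one> = \<one>"
      "\<And>i u v. i \<in> A \<Longrightarrow> u \<in> M \<Longrightarrow> v \<in> M \<Longrightarrow> \<chi> i (u \<otimes> v) = \<chi> i u \<otimes> \<chi> i v"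
    and dist: "\<And>i j. i \<in> A \<Longrightarrow> j \<in> A \<Longrightarrow> i \<noteq> j \<Longrightarrow> \<exists>u\<in>M. \<chi> i u \<noteq> \<chi> j u"
    and c: "\<And>i. i \<in> A \<Longrightarrow> c i \<in> carrier R"
    and zero: "\<And>z. z \<in> M \<Longrightarrow> (\<Oplus>i\<in>A. c i \<otimes> \<chi> i z) = \<zero>"
  shows "\<forall>i\<in>A. c i = \<zero>"
  using assms(1) \<chi> dist c zero
proof (induction A arbitrary: c rule: finite_induct)
  case (insert j A)
  note ch = insert.prems(1-3) and cc = insert.prems(5)
  have c0: "c i = \<zero>" if i: "i \<in> A" for i
  proof -
    obtain u where u: "u \<in> M" "\<chi> i u \<noteq> \<chi> j u"
      using insert.prems(4)[of i j] i insert.hyps(2) by auto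
    have ch_u: "\<chi> k u \<in> carrier R" if "k \<in> insert j A" for k
      using ch(1)[OF that u(1)] .
    have "\<forall>k\<in>A. c k \<otimes> (\<chi> k u \<ominus> \<chi> j u) = \<zero>"
    proof (rule insert.IH)
      fix z assume z: "z \<in> M"
      have cz: "\<chi> k z \<in> carrier R" if "k \<in> insert j A" for k
        using ch(1)[OF that z] .
      have closed: "c k \<otimes> \<chi> k z \<in> carrier R" if "k \<in> insert j A" for k
        using cc[OF that] cz[OF that] by simp
      have S1: "c j \<otimes> (\<chi> j u \<otimes> \<chi> j z) \<oplus> (\<Oplus>k\<in>A. c k \<otimes> (\<chi> k u \<otimes> \<chi> k z)) = \<zero>"
      proof -
        have "(\<Oplus>k\<in>insert j A. c k \<otimes> (\<chi> k u \<otimes> \<chi> k z)) = (\<Oplus>k\<in>insert j A. c k \<otimes> \<chi> k (u \<otimes> z))"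
          by (rule finsum_cong') (use ch(3) u(1) z cc ch_u cz in auto)
        thus ?thesis
          using insert.prems(6)[OF M(2)[OF u(1) z]] insert.hyps cc ch_u cz
          by (subst (asm) finsum_insert) auto
      qed
      have S2: "\<chi> j u \<otimes> (c j \<otimes> \<chi> j z) \<oplus> (\<Oplus>k\<in>A. \<chi> j u \<otimes> (c k \<otimes> \<chi> k z)) = \<zero>"
      proof -
        have "\<chi> j u \<otimes> (\<Oplus>k\<in>insert j A. c k \<otimes> \<chi> k z) = (\<Oplus>k\<in>insert j A. \<chi> j u \<otimes> (c k \<otimes> \<chi> k z))"
          by (rule finsum_rdistr) (use insert.hyps ch_u closed in auto)
        thus ?thesis
          using insert.prems(6)[OF z] insert.hyps closed ch_u
          by (simp add: finsum_insert Pi_def)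
      qed
      \<comment> \<open>\<open>?X\<close> and \<open>?Y\<close> are the parts over \<open>A\<close>
        of the two relations; \<open>?Z\<close> is their difference.\<close>
      let ?X = "\<Oplus>k\<in>A. c k \<otimes> (\<chi> k u \<otimes> \<chi> k z)" and ?Y = "\<Oplus>k\<in>A. \<chi> j u \<otimes> (c k \<otimes> \<chi> k z)"
        and ?Z = "\<Oplus>k\<in>A. c k \<otimes> (\<chi> k u \<ominus> \<chi> j u) \<otimes> \<chi> k z"
      have XYZ: "?X \<in> carrier R" "?Y \<in> carrier R" "?Z \<in> carrier R"
        using cc ch_u cz by (auto intro!: finsum_closed)
      have "?Y \<oplus> ?Z = (\<Oplus>k\<in>A. \<chi> j u \<otimes> (c k \<otimes> \<chi> k z) \<oplus> c k \<otimes> (\<chi> k u \<ominus> \<chi> j u) \<otimes> \<chi> k z)"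
        by (rule finsum_addf[symmetric]) (use cc ch_u cz in auto)
      also have "\<dots> = ?X"
      proof (rule finsum_cong')
        fix k assume "k \<in> A"
        hence "c k \<in> carrier R" "\<chi> k u \<in> carrier R" "\<chi> j u \<in> carrier R" "\<chi> k z \<in> carrier R"
          using cc ch_u cz by auto
        thus "\<chi> j u \<otimes> (c k \<otimes> \<chi> k z) \<oplus> c k \<otimes> (\<chi> k u \<ominus> \<chi> j u) \<otimes> \<chi> k z = c k \<otimes> (\<chi> k u \<otimes> \<chi> k z)"
          by algebra
      qed (use cc ch_u cz in auto)
      finally have "?Y \<oplus> ?Z = ?X" .
      moreover have "c j \<otimes> (\<chi> j u \<otimes> \<chi> j z) = \<chi> j u \<otimes> (c j \<otimes> \<chi> j z)"
        using cc ch_u cz by (simp add: m_lcomm)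
      moreover have "\<chi> j u \<otimes> (c j \<otimes> \<chi> j z) \<in> carrier R"
        using cc ch_u cz by simp
      ultimately have "(\<chi> j u \<otimes> (c j \<otimes> \<chi> j z) \<oplus> ?Y) \<oplus> ?Z = \<zero>"
        using S1 XYZ by (simp add: a_assoc)
      thus "?Z = \<zero>"
        unfolding S2 using XYZ by simp
    qed (use insert.prems ch_u in auto)
    hence "c i \<otimes> (\<chi> i u \<ominus> \<chi> j u) = \<zero>"
      using i by blast
    thus ?thesis
      using integral_iff[of "c i" "\<chi> i u \<ominus> \<chi> j u"] cc ch_u i u(2) by auto
  qed
  \<comment> \<open>The coefficients on \<open>A\<close> vanish, so the relation at \<one> leaves
    only \<open>c j\<close>.\<close>
  have "(\<Oplus>k\<in>insert j A. c k \<otimes> \<chi> k \<one>) = c j \<oplus> (\<Oplus>k\<in>A. c k \<otimes> \<chi> k \<one>)"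
    using insert.hyps cc ch(2) by (subst finsum_insert) auto
  also have "(\<Oplus>k\<in>A. c k \<otimes> \<chi> k \<one>) = (\<Oplus>k\<in>A. \<zero>)"
    by (rule finsum_cong') (use c0 ch(2) in auto)
  also have "(\<Oplus>k\<in>A. \<zero>) = \<zero>"
    by (rule finsum_zero)
  finally have "c j = \<zero>"
    using insert.prems(6)[OF M(1)] cc by simp
  thus ?case
    using c0 by auto
qed simp

text \<open>This collects what the contradiction uses of \<open>F3\<close> and the W-group. Words
  act through \<open>ev\<close> instead of classes; by \<open>ev_eq\<close> the action is faithful
  modulo \<open>wrel\<close>, and by \<open>ev_K\<close> and \<open>ev_fixed\<close> its fixed field
  is \<open>K\<close>.\<close>

locale w5_extension = algebraic_closure L K for L (structure) and K +
  fixes M :: "'a set" and ev :: "nat list \<Rightarrow> 'a \<Rightarrow> 'a"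
  assumes subfield_M: "subfield M L" and K_M: "K \<subseteq> M"
    and ev_hom: "w \<in> letters5 \<Longrightarrow> ev w \<in> ring_hom (L\<lparr>carrier := M\<rparr>) (L\<lparr>carrier := M\<rparr>)"
    and ev_K: "\<lbrakk> w \<in> letters5; k \<in> K \<rbrakk> \<Longrightarrow> ev w k = k"
    and ev_append: "\<lbrakk> u \<in> letters5; v \<in> letters5; x \<in> M \<rbrakk> \<Longrightarrow> ev (u @ v) x = ev u (ev v x)"
    and ev_Nil: "x \<in> M \<Longrightarrow> ev [] x = x"
    and ev_eq: "\<lbrakk> u \<in> letters5; v \<in> letters5 \<rbrakk> \<Longrightarrow> (\<forall>x\<in>M. ev u x = ev v x) \<longleftrightarrow> wrel u v"
    and ev_fixed: "\<lbrakk> x \<in> M; \<And>w. w \<in> letters5 \<Longrightarrow> ev w x = x \<rbrakk> \<Longrightarrow> x \<in> K"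
    and sqrt_K_M: "\<lbrakk> x \<in> carrier L; x \<otimes> x \<in> K \<rbrakk> \<Longrightarrow> x \<in> M"
    and sqrt_norm_M: "\<lbrakk> x \<in> K; y \<in> K; \<alpha> \<in> carrier L; \<alpha> \<otimes> \<alpha> \<in> K; \<beta> \<in> carrier L; \<beta> \<noteq> \<zero>;
        \<beta> \<otimes> \<beta> = x \<otimes> x \<ominus> (\<alpha> \<otimes> \<alpha>) \<otimes> (y \<otimes> y); \<omega> \<in> carrier L; \<omega> \<otimes> \<omega> = x \<oplus> y \<otimes> \<alpha> \<rbrakk>
      \<Longrightarrow> \<omega> \<in> M"
    and two: "\<one> \<oplus> \<one> \<noteq> \<zero>"
begin

section \<open>Elementary properties of the action of words\<close>

lemma M_carrier: "x \<in> M \<Longrightarrow> x \<in> carrier L"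
  using subfieldE(3)[OF subfield_M] by blast

lemma K_carrier: "x \<in> K \<Longrightarrow> x \<in> carrier L"
  using subfieldE(3)[OF subfield_axioms] by blast

lemmas K_closed = subringE(2,3,5-7)[OF subfieldE(1)[OF subfield_axioms]]
lemmas M_closed = subringE(2,3,5-7)[OF subfieldE(1)[OF subfield_M]]

lemma K_minus: "x \<in> K \<Longrightarrow> y \<in> K \<Longrightarrow> x \<ominus> y \<in> K"
  unfolding a_minus_def using K_closed by simp

lemma ev_props:
  assumes "w \<in> letters5"
  shows "x \<in> M \<Longrightarrow> ev w x \<in> M"
    and "x \<in> M \<Longrightarrow> y \<in> M \<Longrightarrow> ev w (x \<oplus> y) = ev w x \<oplus> ev w y"
    and "x \<in> M \<Longrightarrow> y \<in> M \<Longrightarrow> ev w (x \<otimes> y) = ev w x \<otimes> ev w y"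
    and "ev w \<one> = \<one>" "ev w \<zero> = \<zero>"
    and "x \<in> M \<Longrightarrow> ev w (\<ominus> x) = \<ominus> ev w x"
proof -
  note h = ev_hom[OF assms]
  show cl: "ev w x \<in> M" if "x \<in> M" for x
    using ring_hom_memE(1)[OF h] that by simp
  show add: "ev w (x \<oplus> y) = ev w x \<oplus> ev w y" if "x \<in> M" "y \<in> M" for x y
    using ring_hom_memE(3)[OF h] that by simp
  show "ev w (x \<otimes> y) = ev w x \<otimes> ev w y" if "x \<in> M" "y \<in> M" for x y
    using ring_hom_memE(2)[OF h] that by simp
  show "ev w \<one> = \<one>"
    using ring_hom_memE(4)[OF h] by simp
  show z: "ev w \<zero> = \<zero>"
    using ev_K[OF assms K_closed(1)] .
  show "ev w (\<ominus> x) = \<ominus> ev w x" if x: "x \<in> M" for x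
  proof -
    have "ev w x \<oplus> ev w (\<ominus> x) = \<zero>"
      using add[OF x M_closed(3)[OF x]] z x M_carrier by (simp add: r_neg)
    thus ?thesis
      using minus_equality[of "ev w (\<ominus> x)" "ev w x"] M_carrier cl x M_closed(3) by (simp add: a_comm)
  qed
qed

lemma letter [simp]: "i < 5 \<Longrightarrow> [i] \<in> letters5"
  by simp

lemma fixed_by_letters:
  assumes "x \<in> M" "\<And>i. i < 5 \<Longrightarrow> ev [i] x = x"
  shows "x \<in> K"
proof (rule ev_fixed[OF assms(1)])
  show "ev w x = x" if "w \<in> letters5" for w
    using that
  proof (induction w)
    case (Cons i w)
    thus ?case
      using ev_append[of "[i]" w x] assms by simp
  qed (use assms(1) ev_Nil in simp)
qed

lemma double_eq_zero:
  assumes "x \<in> carrier L" "x = \<ominus> x"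
  shows "x = \<zero>"
proof -
  have "(\<one> \<oplus> \<one>) \<otimes> x = x \<oplus> x"
    using assms(1) by (simp add: l_distr)
  also have "\<dots> = x \<oplus> (\<ominus> x)"
    using assms(2) by simp
  also have "\<dots> = \<zero>"
    using assms(1) by (rule r_neg)
  finally show ?thesis
    using integral_iff[of "\<one> \<oplus> \<one>" x] assms(1) two by simp
qed

section \<open>Elements of the group ring acting on \<open>M\<close>\<close>

definition rep :: "nat list \<Rightarrow> nat list" where
  "rep w = (SOME v. v \<in> wclass w)"

text \<open>One word per class: a finite index set that turns sums over the group into sums over
  words.\<close>

definition Reps :: "nat list set" where
  "Reps = rep ` letters5"

lemma rep_wrel: "w \<in> letters5 \<Longrightarrow> wrel w (rep w)"
  unfolding rep_def wclass_def by (simp, rule someI, rule wrel.refl)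

lemma rep_letters5: "w \<in> letters5 \<Longrightarrow> rep w \<in> letters5"
  using rep_wrel wrel_letters5 by blast

lemma rep_cong: "wrel u v \<Longrightarrow> rep u = rep v"
  using wclass_eq_iff wrel_letters5 unfolding rep_def by metis

lemma Reps_props: "finite Reps" "Reps \<subseteq> letters5" "r \<in> Reps \<Longrightarrow> rep r = r"
proof -
  have eq: "Reps = (\<lambda>A. SOME v. v \<in> A) ` carrier W5"
    unfolding Reps_def rep_def by (simp add: image_image)
  show "finite Reps"
    unfolding eq by (rule finite_imageI[OF finite_W5])
  show "Reps \<subseteq> letters5"
    unfolding Reps_def using rep_letters5 by blast
  show "rep r = r" if "r \<in> Reps" for r
    using that rep_cong[OF rep_wrel] unfolding Reps_def by force
qed

lemma Reps_letters5: "r \<in> Reps \<Longrightarrow> r \<in> letters5"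
  using Reps_props(2) by blast

text \<open>Left multiplication by a generator, transferred to representatives. For a letter it is
  an involution of \<open>Reps\<close>, hence a permutation suited to reindexing sums.\<close>

definition twist :: "nat \<Rightarrow> nat list \<Rightarrow> nat list" where
  "twist i w = rep (i # w)"

lemma twist_Reps: "i < 5 \<Longrightarrow> r \<in> Reps \<Longrightarrow> twist i r \<in> Reps"
  unfolding twist_def Reps_def using Reps_letters5[unfolded Reps_def] by auto

lemma twist_twist:
  assumes "i < 5" "r \<in> Reps"
  shows "twist i (twist i r) = r"
proof -
  have r: "r \<in> letters5"
    using Reps_letters5[OF assms(2)] .
  have "wrel (i # r) (twist i r)"
    unfolding twist_def using rep_wrel[of "i # r"] assms(1) r by simp
  hence "wrel ([i] @ twist i r) ([i] @ (i # r))"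
    using assms(1) by (intro wrel.cong wrel.sym[OF \<open>wrel (i # r) (twist i r)\<close>] wrel.refl) simp
  moreover have "wrel ([i, i] @ r) ([] @ r)"
    using assms(1) r by (intro wrel.cong wrel.invol wrel.refl)
  ultimately have "wrel (i # twist i r) r"
    using wrel.trans by fastforce
  thus ?thesis
    using rep_cong Reps_props(3)[OF assms(2)] unfolding twist_def[of i "twist i r"] by metis
qed

lemma bij_twist: "i < 5 \<Longrightarrow> bij_betw (twist i) Reps Reps"
  by (rule bij_betwI[where g = "twist i"]) (auto simp: twist_Reps twist_twist)

text \<open>The element of the group ring with coefficients \<open>c\<close>, applied to
  \<open>z\<close>. When \<open>c\<close> is a character with values 1 and -1, this is a Lagrange
  resolvent.\<close>

definition lc :: "(nat list \<Rightarrow> 'a) \<Rightarrow> 'a \<Rightarrow> 'a" where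
  "lc c z = (\<Oplus>r\<in>Reps. c r \<otimes> ev r z)"

lemma ev_finsum:
  assumes "w \<in> letters5" "finite A" "\<And>i. i \<in> A \<Longrightarrow> f i \<in> M"
  shows "(\<Oplus>i\<in>A. f i) \<in> M \<and> ev w (\<Oplus>i\<in>A. f i) = (\<Oplus>i\<in>A. ev w (f i))"
  using assms(2,3)
proof (induction A rule: finite_induct)
  case empty
  show ?case
    using ev_props(5)[OF assms(1)] M_closed(1) by simp
next
  case (insert j A)
  have "f \<in> A \<rightarrow> carrier L" "(\<lambda>i. ev w (f i)) \<in> A \<rightarrow> carrier L"
    using insert.prems M_carrier ev_props(1)[OF assms(1)] by auto
  thus ?case
    using insert M_carrier ev_props(1,2)[OF assms(1)] M_closed(5) by simp
qed

lemma lc_closed: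
  assumes "\<And>w. c w \<in> K" "z \<in> M"
  shows "lc c z \<in> M"
proof -
  have "c r \<otimes> ev r z \<in> M" if "r \<in> Reps" for r
    using M_closed(4)[OF subsetD[OF K_M assms(1)] ev_props(1)[OF Reps_letters5[OF that] assms(2)]] .
  thus ?thesis
    unfolding lc_def by (intro conjunct1[OF ev_finsum[OF letters5_Nil Reps_props(1)]])
qed

text \<open>The letter \<open>i\<close> carries the term of r to that of ir. Substituting s = ir
  turns the coefficient at r into the one at is, because a generator is its own inverse.\<close>

lemma ev_lc:
  assumes c: "\<And>w. c w \<in> K" "\<And>u v. wrel u v \<Longrightarrow> c u = c v" and z: "z \<in> M" and i: "i < 5"
  shows "ev [i] (lc c z) = lc (\<lambda>w. c (i # w)) z"
proof -
  have cM: "c w \<in> M" for w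
    using c(1) K_M by blast
  have cl: "c r \<otimes> ev r z \<in> M" if "r \<in> Reps" for r
    using cM ev_props(1)[OF Reps_letters5[OF that] z] M_closed(4) by blast
  have ct: "c (twist i s) = c (i # s)" if "s \<in> Reps" for s
    using c(2)[OF rep_wrel[of "i # s"]] Reps_letters5[OF that] i unfolding twist_def by simp
  have clt: "c (twist i s) \<otimes> ev s z \<in> carrier L" if "s \<in> Reps" for s
    using cM ev_props(1)[OF Reps_letters5[OF that] z] M_carrier by simp
  have "ev [i] (lc c z) = (\<Oplus>r\<in>Reps. ev [i] (c r \<otimes> ev r z))"
    unfolding lc_def using cl by (intro conjunct2[OF ev_finsum[OF letter[OF i] Reps_props(1)]])
  \<comment> \<open>The argument of \<open>c\<close> is written as a double \<open>twist\<close>, so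
    that the summand depends on \<open>twist i r\<close> alone, as reindexing requires.\<close>
  also have "\<dots> = (\<Oplus>r\<in>Reps. c (twist i (twist i r)) \<otimes> ev (twist i r) z)"
  proof (rule finsum_cong')
    fix r assume r: "r \<in> Reps"
    note rl = Reps_letters5[OF r]
    have "wrel (i # r) (twist i r)"
      unfolding twist_def using rep_wrel[of "i # r"] i rl by simp
    hence "ev (twist i r) z = ev (i # r) z"
      using ev_eq[of "i # r" "twist i r"] i rl Reps_letters5[OF twist_Reps[OF i r]] z by simp
    also have "\<dots> = ev [i] (ev r z)"
      using ev_append[of "[i]" r z] i rl z by simp
    finally show "ev [i] (c r \<otimes> ev r z) = c (twist i (twist i r)) \<otimes> ev (twist i r) z"
      using ev_props(3)[OF letter[OF i] cM ev_props(1)[OF rl z]] ev_K[OF letter[OF i] c(1)]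
        twist_twist[OF i r] by simp
  qed (use clt twist_Reps[OF i] in auto)
  also have "\<dots> = (\<Oplus>s\<in>twist i ` Reps. c (twist i s) \<otimes> ev s z)"
    by (rule finsum_reindex[symmetric]) (use clt bij_twist[OF i] in \<open>auto simp: bij_betw_def\<close>)
  also have "\<dots> = (\<Oplus>s\<in>Reps. c (twist i s) \<otimes> ev s z)"
    using bij_twist[OF i] by (simp add: bij_betw_def)
  also have "\<dots> = lc (\<lambda>w. c (i # w)) z"
    unfolding lc_def by (rule finsum_cong') (use ct clt in auto)
  finally show ?thesis .
qed

lemma lc_minus:
  assumes "\<And>w. c w \<in> K" "z \<in> M"
  shows "lc (\<lambda>w. \<ominus> c w) z = \<ominus> lc c z"
proof -
  have cl: "c r \<otimes> ev r z \<in> carrier L" "c r \<in> carrier L" "ev r z \<in> carrier L" if "r \<in> Reps" for r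
    using assms K_carrier ev_props(1)[OF Reps_letters5[OF that]] M_carrier by auto
  have "lc (\<lambda>w. \<ominus> c w) z = (\<Oplus>r\<in>Reps. (\<ominus> \<one>) \<otimes> (c r \<otimes> ev r z))"
    unfolding lc_def by (rule finsum_cong') (use cl in \<open>auto simp: l_minus\<close>)
  also have "\<dots> = (\<ominus> \<one>) \<otimes> lc c z"
    unfolding lc_def by (rule finsum_rdistr[symmetric]) (use cl Reps_props(1) in auto)
  finally show ?thesis
    using M_carrier[OF lc_closed[OF assms]] by (simp add: l_minus)
qed

text \<open>Representatives of distinct classes act as distinct homomorphisms, so Dedekind
  independence applies; the coefficient at the trivial class is not zero.\<close>

lemma lc_nonzero:
  assumes c: "\<And>w. c w \<in> K" "\<And>u v. wrel u v \<Longrightarrow> c u = c v" and "c [] \<noteq> \<zero>"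
  shows "\<exists>z\<in>M. lc c z \<noteq> \<zero>"
proof (rule ccontr)
  assume "\<not> ?thesis"
  hence z: "(\<Oplus>r\<in>Reps. c r \<otimes> ev r z) = \<zero>" if "z \<in> M" for z
    using that unfolding lc_def by blast
  have "\<forall>r\<in>Reps. c r = \<zero>"
  proof (rule dedekind_independence[where M = M and \<chi> = ev])
    fix r s assume rs: "r \<in> Reps" "s \<in> Reps" "r \<noteq> s"
    hence "\<not> wrel r s"
      using rep_cong[of r s] Reps_props(3) by auto
    thus "\<exists>u\<in>M. ev r u \<noteq> ev s u"
      using ev_eq Reps_letters5 rs(1,2) by blast
  qed (use Reps_props(1) M_closed M_carrier ev_props Reps_letters5 c(1) K_carrier z in auto)
  hence "c (rep []) = \<zero>"
    unfolding Reps_def by simp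
  thus False
    using c(2)[OF rep_wrel[OF letters5_Nil]] assms(3) by simp
qed

section \<open>Square roots of elements of \<open>K\<close> as common eigenvectors\<close>

definition sgn_if :: "bool \<Rightarrow> 'a \<Rightarrow> 'a" where
  "sgn_if b x = (if b then \<ominus> x else x)"

text \<open>A common eigenvector of the generators, hence a square root of an element of
  \<open>K\<close>. Only the five letters are recorded; the sixth involution negates
  \<open>x\<close> exactly when \<open>S\<close> contains an odd number of them.\<close>

definition has_sign :: "nat set \<Rightarrow> 'a \<Rightarrow> bool" where
  "has_sign S x \<longleftrightarrow> x \<in> M \<and> x \<noteq> \<zero> \<and> (\<forall>i<5. ev [i] x = sgn_if (i \<in> S) x)"

lemma has_signD:
  assumes "has_sign S x"
  shows "x \<in> M" "x \<in> carrier L" "x \<noteq> \<zero>"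
    and "i < 5 \<Longrightarrow> i \<in> S \<Longrightarrow> ev [i] x = \<ominus> x" "i < 5 \<Longrightarrow> i \<notin> S \<Longrightarrow> ev [i] x = x"
  using assms M_carrier unfolding has_sign_def sgn_if_def by auto

lemma has_sign_square:
  assumes "has_sign S x"
  shows "x \<otimes> x \<in> K"
proof (rule fixed_by_letters)
  note x = has_signD(1,2)[OF assms]
  show "x \<otimes> x \<in> M"
    using x(1) M_closed(4) by blast
  fix i :: nat assume i: "i < 5"
  show "ev [i] (x \<otimes> x) = x \<otimes> x"
    using ev_props(3)[OF letter[OF i] x(1,1)] has_signD(4,5)[OF assms i] x(2)
    by (cases "i \<in> S") (auto simp: l_minus r_minus)
qed

lemma has_sign_mult:
  assumes "has_sign S x" "has_sign T y"
  shows "has_sign ((S - T) \<union> (T - S)) (x \<otimes> y)"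
proof -
  note x = has_signD(1-3)[OF assms(1)] and y = has_signD(1-3)[OF assms(2)]
  have "ev [i] (x \<otimes> y) = sgn_if (i \<in> (S - T) \<union> (T - S)) (x \<otimes> y)" if i: "i < 5" for i
    using ev_props(3)[OF letter[OF i] x(1) y(1)] has_signD(4,5)[OF assms(1) i] has_signD(4,5)[OF assms(2) i] x(2) y(2)
    by (cases "i \<in> S"; cases "i \<in> T") (auto simp: sgn_if_def l_minus r_minus)
  thus ?thesis
    unfolding has_sign_def using M_closed(4)[OF x(1) y(1)] integral_iff[OF x(2) y(2)] x(3) y(3) by auto
qed

text \<open>All relations hold in a commutative group of exponent two, so any choice of signs on the
  letters gives a character; it is \<open>heis\<close> with empty second set. A nonzero resolvent of
  this character is the eigenvector.\<close>

lemma exists_has_sign: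
  obtains x where "has_sign S x"
proof -
  define c where "c w = sgn_if (snd (snd (heis S {} w))) \<one>" for w
  have h: "heis S {} w = (False, False, snd (snd (heis S {} w)))" for w
  proof (induction w)
    case (Cons i w)
    thus ?case
      by (cases "heis S {} w") auto
  qed simp
  have "heis S {} ([0,1,2,3,4] @ [0,1,2,3,4]) = (False, False, False)"
    unfolding heis_append by (subst (1 2) h) simp
  hence rel: "wrel u v \<Longrightarrow> c u = c v" for u v
    unfolding c_def using heis_wrel[of S "{}" u v] by simp
  have cK: "c w \<in> K" for w
    unfolding c_def sgn_if_def using K_closed(2,3) by auto
  have "c [] \<noteq> \<zero>"
    unfolding c_def sgn_if_def by simp
  hence "\<exists>z\<in>M. lc c z \<noteq> \<zero>"
    by (intro lc_nonzero cK rel)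
  then obtain z where z: "z \<in> M" "lc c z \<noteq> \<zero>" ..
  have "ev [i] (lc c z) = sgn_if (i \<in> S) (lc c z)" if i: "i < 5" for i
  proof -
    have "c (i # w) = sgn_if (i \<in> S) (c w)" for w
      unfolding c_def by (cases "heis S {} w") (auto simp: sgn_if_def)
    hence "ev [i] (lc c z) = lc (\<lambda>w. sgn_if (i \<in> S) (c w)) z"
      using ev_lc[OF cK rel z(1) i] by simp
    thus ?thesis
      using lc_minus[OF cK z(1)] by (cases "i \<in> S") (auto simp: sgn_if_def)
  qed
  hence "has_sign S (lc c z)"
    unfolding has_sign_def using z(2) lc_closed[of c, OF cK z(1)] by blast
  thus thesis
    by (rule that)
qed

text \<open>The dihedral representation yields \<open>w0\<close> and \<open>w1\<close>, which
  letters of \<open>S\<close> exchange, while letters of \<open>T\<close> fix \<open>w0\<close> and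
  negate \<open>w1\<close>. Their squares are x + y\<alpha> and x - y\<alpha> with x and y in
  \<open>K\<close>, so their product is the required \<beta>.\<close>

lemma exists_norm:
  assumes ST: "S \<inter> T = {}" and rel: "heis S T ([0,1,2,3,4] @ [0,1,2,3,4]) = (False, False, False)"
    and i0: "i0 < 5" "i0 \<in> S" and a: "has_sign S \<alpha>"
  obtains x y \<beta> where "x \<in> K" "y \<in> K" "has_sign T \<beta>" "\<beta> \<otimes> \<beta> = x \<otimes> x \<ominus> (\<alpha> \<otimes> \<alpha>) \<otimes> (y \<otimes> y)"
proof -
  \<comment> \<open>\<open>f False w\<close> and \<open>f True w\<close> are the coordinates of the
    image of the first basis vector under the signed permutation matrix of \<open>w\<close>.\<close>
  define f where "f j w = (case heis S T w of (p, q, r) \<Rightarrow> if r = j then sgn_if p \<one> else \<zero>)" for j w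
  have fK: "f j w \<in> K" for j w
    unfolding f_def sgn_if_def using K_closed(1-3) by (auto split: prod.splits)
  have frel: "f j u = f j v" if "wrel u v" for j u v
    unfolding f_def using heis_wrel[OF ST rel that] by simp
  have "f False [] \<noteq> \<zero>"
    unfolding f_def sgn_if_def by simp
  hence "\<exists>z\<in>M. lc (f False) z \<noteq> \<zero>"
    by (intro lc_nonzero fK frel)
  then obtain z where z: "z \<in> M" "lc (f False) z \<noteq> \<zero>" ..
  define w0 where "w0 = lc (f False) z"
  define w1 where "w1 = lc (f True) z"
  have wM: "w0 \<in> M" "w1 \<in> M"
    unfolding w0_def w1_def using lc_closed[OF fK z(1)] by auto
  note wL = wM[THEN M_carrier]
  have S: "ev [i] w0 = w1" "ev [i] w1 = w0" if i: "i < 5" "i \<in> S" for i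
  proof -
    have "i \<notin> T"
      using i(2) ST by blast
    hence "f j (i # w) = f (\<not> j) w" for j w
      unfolding f_def using i(2) by (cases "heis S T w") auto
    thus "ev [i] w0 = w1" "ev [i] w1 = w0"
      unfolding w0_def w1_def using ev_lc[OF fK frel z(1) i(1)] by auto
  qed
  have T: "ev [i] w0 = w0" "ev [i] w1 = \<ominus> w1" if i: "i < 5" "i \<in> T" for i
  proof -
    have "i \<notin> S"
      using i(2) ST by blast
    hence "f False (i # w) = f False w" "f True (i # w) = \<ominus> f True w" for w
      unfolding f_def sgn_if_def using i(2) by (cases "heis S T w"; auto)+
    thus "ev [i] w0 = w0" "ev [i] w1 = \<ominus> w1"
      unfolding w0_def w1_def using ev_lc[OF fK frel z(1) i(1)] lc_minus[OF fK z(1)] by auto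
  qed
  have N: "ev [i] w0 = w0" "ev [i] w1 = w1" if i: "i < 5" "i \<notin> S" "i \<notin> T" for i
  proof -
    have "f j (i # w) = f j w" for j w
      unfolding f_def using i by (cases "heis S T w") auto
    thus "ev [i] w0 = w0" "ev [i] w1 = w1"
      unfolding w0_def w1_def using ev_lc[OF fK frel z(1) i(1)] by auto
  qed
  have "w0 \<noteq> \<zero>"
    using z(2) unfolding w0_def .
  \<comment> \<open>Independence was applied to \<open>w0\<close> only; the letter \<open>i0\<close>
    maps \<open>w1\<close> to \<open>w0\<close>.\<close>
  moreover have "w1 \<noteq> \<zero>"
    using S(2)[OF i0] \<open>w0 \<noteq> \<zero>\<close> ev_props(5)[OF letter[OF i0(1)]] by auto
  ultimately have nz: "w0 \<otimes> w1 \<noteq> \<zero>"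
    using integral_iff[OF wL] by simp
  have ev_m: "ev [i] (x \<otimes> y) = ev [i] x \<otimes> ev [i] y" if "i < 5" "x \<in> M" "y \<in> M" for i x y
    using ev_props(3)[OF letter[OF that(1)] that(2,3)] .
  have sign: "has_sign T (w0 \<otimes> w1)"
  proof -
    have "ev [i] (w0 \<otimes> w1) = sgn_if (i \<in> T) (w0 \<otimes> w1)" if i: "i < 5" for i
    proof -
      consider "i \<in> S" "i \<notin> T" | "i \<in> T" | "i \<notin> S" "i \<notin> T"
        using ST by blast
      thus ?thesis
        by cases (use ev_m[OF i wM] S[OF i] T[OF i] N[OF i] wL in
            \<open>auto simp: sgn_if_def r_minus m_comm\<close>)
    qed
    thus ?thesis
      unfolding has_sign_def using nz M_closed(4)[OF wM] by blast
  qed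
  note aD = has_signD[OF a]
  \<comment> \<open>Squaring removes the signs coming from \<open>T\<close>: letters of
    \<open>S\<close> exchange \<open>g0\<close> and \<open>g1\<close>, all others fix both.\<close>
  define g0 where "g0 = w0 \<otimes> w0"
  define g1 where "g1 = w1 \<otimes> w1"
  have gM: "g0 \<in> M" "g1 \<in> M"
    unfolding g0_def g1_def using M_closed(4) wM by auto
  note gL = gM[THEN M_carrier]
  have gS: "ev [i] g0 = g1" "ev [i] g1 = g0" if "i < 5" "i \<in> S" for i
    unfolding g0_def g1_def using ev_m[OF that(1)] wM S[OF that] by auto
  have gN: "ev [i] g0 = g0" "ev [i] g1 = g1" if i: "i < 5" "i \<notin> S" for i
    unfolding g0_def g1_def using ev_m[OF i(1)] wM T[OF i(1)] N[OF i] wL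
    by (cases "i \<in> T"; auto simp: l_minus r_minus)+
  let ?two = "\<one> \<oplus> \<one>"
  define h where "h = inv ?two"
  have twoK: "?two \<in> K - {\<zero>}"
    using K_closed two by auto
  have hK: "h \<in> K" and h: "?two \<otimes> h = \<one>"
    unfolding h_def using subfield_m_inv[OF subfield_axioms twoK] by auto
  note hL = K_carrier[OF hK]
  have hM: "h \<in> M"
    using hK K_M by blast
  have ia: "inv \<alpha> \<in> M" "\<alpha> \<otimes> inv \<alpha> = \<one>"
    using subfield_m_inv[OF subfield_M, of \<alpha>] aD(1,3) by auto
  note iaL = M_carrier[OF ia(1)]
  have ev_ia: "ev [i] (inv \<alpha>) = sgn_if (i \<in> S) (inv \<alpha>)" if i: "i < 5" for i
  proof -
    have eL: "ev [i] (inv \<alpha>) \<in> carrier L"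
      using ev_props(1)[OF letter[OF i] ia(1)] M_carrier by blast
    have "sgn_if (i \<in> S) \<alpha> \<otimes> ev [i] (inv \<alpha>) = \<one>"
      using ev_m[OF i aD(1) ia(1)] ia(2) ev_props(4)[OF letter[OF i]] a i unfolding has_sign_def by simp
    hence "\<alpha> \<otimes> sgn_if (i \<in> S) (ev [i] (inv \<alpha>)) = \<one>"
      using aD(2) eL by (cases "i \<in> S") (auto simp: sgn_if_def l_minus r_minus)
    hence "sgn_if (i \<in> S) (ev [i] (inv \<alpha>)) = inv \<alpha>"
      using comm_inv_char[of \<alpha> "sgn_if (i \<in> S) (ev [i] (inv \<alpha>))"] aD(2) eL by (auto simp: sgn_if_def)
    thus ?thesis
      using minus_minus[OF eL] by (cases "i \<in> S") (auto simp: sgn_if_def)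
  qed
  \<comment> \<open>As \<open>h\<close> is one half, this choice gives \<open>g0\<close> = x +
    y\<alpha> and \<open>g1\<close> = x - y\<alpha>.\<close>
  define x where "x = h \<otimes> (g0 \<oplus> g1)"
  define y where "y = h \<otimes> ((g0 \<ominus> g1) \<otimes> inv \<alpha>)"
  have dM: "g0 \<ominus> g1 \<in> M" "g0 \<oplus> g1 \<in> M"
    unfolding a_minus_def using gM M_closed by auto
  have ev_d: "ev [i] (g0 \<ominus> g1) = ev [i] g0 \<ominus> ev [i] g1" "ev [i] (g0 \<oplus> g1) = ev [i] g0 \<oplus> ev [i] g1"
    if i: "i < 5" for i
    unfolding a_minus_def using ev_props(2,6)[OF letter[OF i]] gM M_closed(3) by auto
  have ev_h: "ev [i] h = h" if i: "i < 5" for i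
    using ev_K[OF letter[OF i] hK] .
  have "x \<in> K"
  proof (rule fixed_by_letters)
    show "x \<in> M"
      unfolding x_def using hM dM M_closed(4) by blast
    fix i :: nat assume i: "i < 5"
    show "ev [i] x = x"
      unfolding x_def using ev_m[OF i hM dM(2)] ev_h[OF i] ev_d(2)[OF i] gS[OF i] gN[OF i] gL
      by (cases "i \<in> S") (auto simp: a_comm)
  qed
  moreover have "y \<in> K"
  proof (rule fixed_by_letters)
    have pM: "(g0 \<ominus> g1) \<otimes> inv \<alpha> \<in> M"
      using dM ia(1) M_closed(4) by blast
    show "y \<in> M"
      unfolding y_def using hM pM M_closed(4) by blast
    fix i :: nat assume i: "i < 5"
    have "(g1 \<ominus> g0) \<otimes> (\<ominus> (inv \<alpha>)) = (g0 \<ominus> g1) \<otimes> inv \<alpha>"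
      using gL iaL by algebra
    hence "ev [i] ((g0 \<ominus> g1) \<otimes> inv \<alpha>) = (g0 \<ominus> g1) \<otimes> inv \<alpha>"
      using ev_m[OF i dM(1) ia(1)] ev_d(1)[OF i] gS[OF i] gN[OF i] ev_ia[OF i]
      by (cases "i \<in> S") (auto simp: sgn_if_def)
    thus "ev [i] y = y"
      unfolding y_def using ev_m[OF i hM pM] ev_h[OF i] by simp
  qed
  moreover have "(w0 \<otimes> w1) \<otimes> (w0 \<otimes> w1) = x \<otimes> x \<ominus> (\<alpha> \<otimes> \<alpha>) \<otimes> (y \<otimes> y)"
  proof -
    have gg: "(w0 \<otimes> w1) \<otimes> (w0 \<otimes> w1) = g0 \<otimes> g1"
      unfolding g0_def g1_def using wL by algebra
    have ay: "\<alpha> \<otimes> y = h \<otimes> (g0 \<ominus> g1)"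
    proof -
      have "\<alpha> \<otimes> y = (\<alpha> \<otimes> inv \<alpha>) \<otimes> (h \<otimes> (g0 \<ominus> g1))"
        unfolding y_def using aD(2) iaL hL gL M_carrier[OF dM(1)] by (simp add: m_assoc m_lcomm m_comm)
      thus ?thesis
        using ia(2) hL gL by simp
    qed
    have yL: "y \<in> carrier L"
      unfolding y_def using hL gL iaL by simp
    have "(\<alpha> \<otimes> \<alpha>) \<otimes> (y \<otimes> y) = (\<alpha> \<otimes> y) \<otimes> (\<alpha> \<otimes> y)"
      using aD(2) yL by algebra
    hence "x \<otimes> x \<ominus> (\<alpha> \<otimes> \<alpha>) \<otimes> (y \<otimes> y) = (h \<otimes> (g0 \<oplus> g1)) \<otimes> (h \<otimes> (g0 \<oplus> g1)) \<ominus> (h \<otimes> (g0 \<ominus> g1)) \<otimes> (h \<otimes> (g0 \<ominus> g1))"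
      unfolding ay x_def by simp
    also have "\<dots> = ((?two \<otimes> h) \<otimes> (?two \<otimes> h)) \<otimes> (g0 \<otimes> g1)"
      using hL gL by algebra
    finally show ?thesis
      unfolding gg h using gL by simp
  qed
  ultimately show thesis
    using that[OF _ _ sign] by blast
qed

text \<open>Let \<omega>^2 = x + y\<alpha>. The involution exchanges \<omega> with its image, so it
  fixes their product, whose square is the norm \<beta>^2. Hence it fixes \<beta>.\<close>

lemma norm_fixed_by_involution:
  assumes xy: "x \<in> K" "y \<in> K" and a: "\<alpha> \<in> M" "\<alpha> \<otimes> \<alpha> \<in> K"
    and b: "\<beta> \<in> M" "\<beta> \<noteq> \<zero>" "\<beta> \<otimes> \<beta> = x \<otimes> x \<ominus> (\<alpha> \<otimes> \<alpha>) \<otimes> (y \<otimes> y)"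
    and w: "w \<in> letters5" "wrel (w @ w) []" and neg: "ev w \<alpha> = \<ominus> \<alpha>"
  shows "ev w \<beta> = \<beta>"
proof -
  note L = a(1)[THEN M_carrier] b(1)[THEN M_carrier] xy[THEN K_carrier]
  have xyM: "x \<in> M" "y \<in> M"
    using xy K_M by auto
  have bK: "\<beta> \<otimes> \<beta> \<in> K"
    unfolding b(3) using xy a(2) K_minus K_closed(4) by simp
  have "x \<oplus> y \<otimes> \<alpha> \<in> carrier L"
    using L by simp
  then obtain \<omega> where om: "\<omega> \<in> carrier L" "\<omega> \<otimes> \<omega> = x \<oplus> y \<otimes> \<alpha>"
    by (rule exists_square_root)
  have oM: "\<omega> \<in> M"
    using sqrt_norm_M[OF xy L(1) a(2) L(2) b(2,3) om] .
  have norm: "(x \<oplus> y \<otimes> \<alpha>) \<otimes> (x \<oplus> y \<otimes> (\<ominus> \<alpha>)) = \<beta> \<otimes> \<beta>"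
    unfolding b(3) using L by algebra
  define \<omega>' where "\<omega>' = ev w \<omega>"
  have o'M: "\<omega>' \<in> M"
    unfolding \<omega>'_def using ev_props(1)[OF w(1) oM] .
  note o'L = M_carrier[OF o'M]
  have "\<omega>' \<otimes> \<omega>' = ev w (x \<oplus> y \<otimes> \<alpha>)"
    unfolding \<omega>'_def om(2)[symmetric] using ev_props(3)[OF w(1) oM oM] by simp
  also have "\<dots> = x \<oplus> y \<otimes> (\<ominus> \<alpha>)"
    using ev_props(2,3)[OF w(1)] ev_K[OF w(1)] xy xyM a(1) M_closed(4) neg by simp
  finally have "(\<omega> \<otimes> \<omega>) \<otimes> (\<omega>' \<otimes> \<omega>') = \<beta> \<otimes> \<beta>"
    using om(2) norm by simp
  moreover have "(\<omega> \<otimes> \<omega>') \<otimes> (\<omega> \<otimes> \<omega>') = (\<omega> \<otimes> \<omega>) \<otimes> (\<omega>' \<otimes> \<omega>')"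
    using om(1) o'L by algebra
  ultimately have pm: "\<omega> \<otimes> \<omega>' = \<beta> \<or> \<omega> \<otimes> \<omega>' = \<ominus> \<beta>"
    using square_eq_iff[of "\<omega> \<otimes> \<omega>'" \<beta>] om(1) o'L L(2) by simp
  have "ev w \<omega>' = \<omega>"
  proof -
    have "ev (w @ w) \<omega> = ev [] \<omega>"
      using ev_eq[of "w @ w" "[]"] w oM by simp
    thus ?thesis
      unfolding \<omega>'_def using ev_append[OF w(1,1) oM] ev_Nil[OF oM] by simp
  qed
  hence "ev w (\<omega> \<otimes> \<omega>') = \<omega> \<otimes> \<omega>'"
    using ev_props(3)[OF w(1) oM o'M] om(1) o'L unfolding \<omega>'_def[symmetric] by (simp add: m_comm)
  thus ?thesis
    using pm ev_props(6)[OF w(1) b(1)] L(2) M_carrier[OF ev_props(1)[OF w(1) b(1)]]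
    by (metis minus_minus)
qed

section \<open>Common slot of the quaternion algebras and its signs\<close>

lemma sign_clash:
  assumes "u \<in> M" "v \<in> M" "u \<otimes> u = v \<otimes> v" "w \<in> letters5" "ev w u = u" "ev w v = \<ominus> v"
  shows "u = \<zero>" "v = \<zero>"
proof -
  note L = assms(1,2)[THEN M_carrier]
  have "u = v \<or> u = \<ominus> v"
    using square_eq_iff[OF L] assms(3) by simp
  \<comment> \<open>Applying \<open>w\<close> to u = v or to u = -v fixes one side and negates the
    other.\<close>
  hence "v = \<ominus> v"
    using assms(5,6) ev_props(6)[OF assms(4,2)] L(2) by auto
  thus "v = \<zero>"
    using double_eq_zero[OF L(2)] by blast
  thus "u = \<zero>"
    using \<open>u = v \<or> u = \<ominus> v\<close> by auto
qed

text \<open>Here \<alpha>, \<beta>, \<gamma>, \<delta> are square roots of a, b, c, d, with their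
  sets written without the sixth involution. Up to a factor in \<open>K\<close>,
  \<alpha>\<beta>\<zeta> is a square root of the common slot f. The two norm equations for f
  determine how the six involutions act on \<zeta>, and these signs are incompatible.\<close>

lemma impossible: False
proof -
  obtain \<alpha> where a: "has_sign {1, 3, 4} \<alpha>"
    by (rule exists_has_sign)
  obtain \<beta> where b: "has_sign {0, 1} \<beta>"
    by (rule exists_has_sign)
  \<comment> \<open>This is (b, ad) = 0. The set {3} is the symmetric difference of {1,3,4} and
    {1,4}, so that \<delta> = \<alpha>\<nu> gets the set {1,4}.\<close>
  obtain p q \<nu> where pq: "p \<in> K" "q \<in> K" and n: "has_sign {3} \<nu>"
    and nu: "\<nu> \<otimes> \<nu> = p \<otimes> p \<ominus> (\<beta> \<otimes> \<beta>) \<otimes> (q \<otimes> q)"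
    by (rule exists_norm[of "{0, 1}" "{3}" 0 \<beta>]) (use b in auto)
  define \<delta> where "\<delta> = \<alpha> \<otimes> \<nu>"
  have "({1, 3, 4} - {3}) \<union> ({3} - {1, 3, 4}) = {1, 4 :: nat}"
    by auto
  hence d: "has_sign {1, 4} \<delta>"
    unfolding \<delta>_def using has_sign_mult[OF a n] by simp
  \<comment> \<open>This is (d, bc) = 0. The set {2,3} is the symmetric difference of {0,1} and
    {0,1,2,3}, the sets of \<beta> and of the \<gamma> to be defined.\<close>
  obtain r s \<mu> where rs: "r \<in> K" "s \<in> K" and m: "has_sign {2, 3} \<mu>"
    and mu: "\<mu> \<otimes> \<mu> = r \<otimes> r \<ominus> (\<delta> \<otimes> \<delta>) \<otimes> (s \<otimes> s)"
    by (rule exists_norm[of "{1, 4}" "{2, 3}" 1 \<delta>]) (use d in auto)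
  define \<gamma> where "\<gamma> = \<beta> \<otimes> \<mu>"
  have "({0, 1} - {2, 3}) \<union> ({2, 3} - {0, 1}) = {0, 1, 2, 3 :: nat}"
    by auto
  hence g: "has_sign {0, 1, 2, 3} \<gamma>"
    unfolding \<gamma>_def using has_sign_mult[OF b m] by simp
  have "({0, 1} - {3}) \<union> ({3} - {0, 1}) = {0, 1, 3 :: nat}"
    by auto
  hence bn: "has_sign {0, 1, 3} (\<beta> \<otimes> \<nu>)"
    using has_sign_mult[OF b n] by simp
  have "({1, 3, 4} - {0, 1}) \<union> ({0, 1} - {1, 3, 4}) = {0, 3, 4 :: nat}"
    by auto
  hence ab: "has_sign {0, 3, 4} (\<alpha> \<otimes> \<beta>)"
    using has_sign_mult[OF a b] by simp
  note L = pq[THEN K_carrier] rs[THEN K_carrier] has_signD(2)[OF a] has_signD(2)[OF b]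
    has_signD(2)[OF n] has_signD(2)[OF m] has_signD(2)[OF d]
  note kM = subsetD[OF K_M]
  have evK: "ev [i] k = k" if "i < 5" "k \<in> K" for i k
    using ev_K[OF letter] that by blast

  \<comment> \<open>In the quaternion algebra with \<open>i\<^sup>2 = A\<close>, \<open>j\<^sup>2 = B\<close>, the common slot is the square of the
    commutator of \<open>i\<close> and \<open>j'\<close>, where \<open>i' = i (p + q j)\<close> and \<open>j' = j (r + s i')\<close> up to scalars;
    it equals \<open>- A B e\<close> up to squares.\<close>
  define A where "A = \<alpha> \<otimes> \<alpha>"
  define B where "B = \<beta> \<otimes> \<beta>"
  have AB: "A \<in> carrier L" "B \<in> carrier L" "A \<in> K" "B \<in> K"
    unfolding A_def B_def using L has_sign_square[OF a] has_sign_square[OF b] by auto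
  define e where "e = r \<otimes> r \<ominus> A \<otimes> ((p \<otimes> s) \<otimes> (p \<otimes> s))"
  have eK: "e \<in> K"
    unfolding e_def using pq rs AB K_closed(4) K_minus by simp
  have eL: "e \<in> carrier L"
    using K_carrier[OF eK] .

  \<comment> \<open>If e = 0, then r^2 = (ps\<alpha>)^2, and letter 1, which negates \<alpha>,
    forces r = 0 and ps = 0. Since s is nonzero, p = 0 and \<mu>^2 = (qs\<alpha>\<beta>)^2; but
    letter 4 fixes \<mu> and negates \<alpha>\<beta>.\<close>
  have "e \<noteq> \<zero>"
  proof
    assume e0: "e = \<zero>"
    define v where "v = (p \<otimes> s) \<otimes> \<alpha>"
    have psK: "p \<otimes> s \<in> K"
      using pq rs K_closed(4) by blast
    have vM: "v \<in> M"
      unfolding v_def using kM[OF psK] has_signD(1)[OF a] M_closed(4) by blast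
    have "v \<otimes> v = A \<otimes> ((p \<otimes> s) \<otimes> (p \<otimes> s))"
      unfolding v_def A_def using L by algebra
    hence rv: "r \<otimes> r = v \<otimes> v"
      using e0 L AB unfolding e_def by simp
    have ev_v: "ev [1] v = \<ominus> v"
      unfolding v_def using ev_props(3)[OF letter kM[OF psK] has_signD(1)[OF a], of 1]
        evK[OF _ psK, of 1] has_signD(4)[OF a, of 1] L by (simp add: r_minus)
    have "r = \<zero>" "v = \<zero>"
      using sign_clash[OF kM[OF rs(1)] vM rv letter, of 1] evK[OF _ rs(1), of 1] ev_v by auto
    hence r0: "r = \<zero>" and ps: "p = \<zero> \<or> s = \<zero>"
      unfolding v_def using L has_signD(3)[OF a] by (auto simp: integral_iff)
    have s0: "s \<noteq> \<zero>"
    proof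
      assume "s = \<zero>"
      hence "\<mu> \<otimes> \<mu> = \<zero>"
        using mu r0 L by simp
      thus False
        using has_signD(3)[OF m] L by (simp add: integral_iff)
    qed
    hence p0: "p = \<zero>"
      using ps by blast
    define u where "u = (q \<otimes> s) \<otimes> (\<alpha> \<otimes> \<beta>)"
    have qsK: "q \<otimes> s \<in> K"
      using pq rs K_closed(4) by blast
    have uM: "u \<in> M"
      unfolding u_def using kM[OF qsK] has_signD(1)[OF ab] M_closed(4) by blast
    have dd: "\<delta> \<otimes> \<delta> = A \<otimes> (\<nu> \<otimes> \<nu>)"
      unfolding \<delta>_def A_def using L by algebra
    have "\<nu> \<otimes> \<nu> = \<ominus> (B \<otimes> (q \<otimes> q))"
      using nu p0 L AB unfolding B_def[symmetric] by (simp add: a_minus_def)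
    hence "\<mu> \<otimes> \<mu> = \<zero> \<otimes> \<zero> \<ominus> (A \<otimes> (\<ominus> (B \<otimes> (q \<otimes> q)))) \<otimes> (s \<otimes> s)"
      using mu r0 dd by simp
    also have "\<dots> = (q \<otimes> s) \<otimes> (q \<otimes> s) \<otimes> (A \<otimes> B)"
      using L AB by algebra
    also have "\<dots> = u \<otimes> u"
      unfolding u_def A_def B_def using L by algebra
    finally have mu_u: "\<mu> \<otimes> \<mu> = u \<otimes> u" .
    have "ev [4] u = \<ominus> u"
      unfolding u_def using ev_props(3)[OF letter kM[OF qsK] has_signD(1)[OF ab], of 4]
        evK[OF _ qsK, of 4] has_signD(4)[OF ab, of 4] L by (simp add: r_minus)
    hence "\<mu> = \<zero>"
      using sign_clash(1)[OF has_signD(1)[OF m] uM mu_u letter, of 4] has_signD(5)[OF m, of 4] by simp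
    thus False
      using has_signD(3)[OF m] by blast
  qed

  have "\<ominus> e \<in> carrier L"
    using eL by simp
  then obtain \<zeta> where zL: "\<zeta> \<in> carrier L" and zz: "\<zeta> \<otimes> \<zeta> = \<ominus> e"
    by (rule exists_square_root)
  have zM: "\<zeta> \<in> M"
    using sqrt_K_M[OF zL] zz K_closed(3)[OF eK] by simp
  have z0: "\<zeta> \<noteq> \<zero>"
  proof
    assume "\<zeta> = \<zero>"
    hence "\<ominus> e = \<zero>"
      using zz by simp
    thus False
      using minus_minus[OF eL] \<open>e \<noteq> \<zero>\<close> by simp
  qed
  have azM: "\<alpha> \<otimes> \<zeta> \<in> M" and bzM: "(\<beta> \<otimes> \<nu>) \<otimes> \<zeta> \<in> M"
    using M_closed(4) has_signD(1)[OF a] has_signD(1)[OF bn] zM by auto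
  \<comment> \<open>The relation (a, bf) = 0: up to squares bf is -ae, the square of
    \<alpha>\<zeta>.\<close>
  have norm1: "(\<alpha> \<otimes> \<zeta>) \<otimes> (\<alpha> \<otimes> \<zeta>) = (A \<otimes> (p \<otimes> s)) \<otimes> (A \<otimes> (p \<otimes> s)) \<ominus> (\<alpha> \<otimes> \<alpha>) \<otimes> (r \<otimes> r)"
  proof -
    have "(\<alpha> \<otimes> \<zeta>) \<otimes> (\<alpha> \<otimes> \<zeta>) = A \<otimes> (\<zeta> \<otimes> \<zeta>)"
      unfolding A_def using L zL by algebra
    also have "\<dots> = (A \<otimes> (p \<otimes> s)) \<otimes> (A \<otimes> (p \<otimes> s)) \<ominus> A \<otimes> (r \<otimes> r)"
      unfolding zz e_def using L AB by algebra
    finally show ?thesis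
      unfolding A_def .
  qed
  \<comment> \<open>The relation (c, df) = 0: since d = a\<nu>^2, up to squares df is -b\<nu>^2 e,
    the square of \<beta>\<nu>\<zeta>.\<close>
  have norm2: "((\<beta> \<otimes> \<nu>) \<otimes> \<zeta>) \<otimes> ((\<beta> \<otimes> \<nu>) \<otimes> \<zeta>)
      = (q \<otimes> (B \<otimes> r)) \<otimes> (q \<otimes> (B \<otimes> r)) \<ominus> (\<gamma> \<otimes> \<gamma>) \<otimes> (p \<otimes> p)"
  proof -
    define N where "N = \<nu> \<otimes> \<nu>"
    have N: "N \<in> carrier L"
      unfolding N_def using L by simp
    \<comment> \<open>The norm equation for \<nu> is solved for b q^2; eliminating q leaves a
      polynomial identity.\<close>
    have bq: "B \<otimes> (q \<otimes> q) = p \<otimes> p \<ominus> N"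
    proof -
      have "N = p \<otimes> p \<ominus> B \<otimes> (q \<otimes> q)"
        unfolding N_def B_def nu ..
      hence "p \<otimes> p \<ominus> N = p \<otimes> p \<ominus> (p \<otimes> p \<ominus> B \<otimes> (q \<otimes> q))"
        by simp
      also have "\<dots> = B \<otimes> (q \<otimes> q)"
        using L AB by algebra
      finally show ?thesis ..
    qed
    have "\<delta> \<otimes> \<delta> = A \<otimes> N"
      unfolding \<delta>_def A_def N_def using L by algebra
    hence "\<mu> \<otimes> \<mu> = r \<otimes> r \<ominus> (A \<otimes> N) \<otimes> (s \<otimes> s)"
      using mu by simp
    moreover have "\<gamma> \<otimes> \<gamma> = B \<otimes> (\<mu> \<otimes> \<mu>)"
      unfolding \<gamma>_def B_def using L by algebra
    ultimately have gg: "\<gamma> \<otimes> \<gamma> = B \<otimes> (r \<otimes> r \<ominus> (A \<otimes> N) \<otimes> (s \<otimes> s))"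
      by simp
    have "(q \<otimes> (B \<otimes> r)) \<otimes> (q \<otimes> (B \<otimes> r)) = (B \<otimes> (r \<otimes> r)) \<otimes> (B \<otimes> (q \<otimes> q))"
      using L AB by algebra
    hence "(q \<otimes> (B \<otimes> r)) \<otimes> (q \<otimes> (B \<otimes> r)) \<ominus> (\<gamma> \<otimes> \<gamma>) \<otimes> (p \<otimes> p)
        = (B \<otimes> (r \<otimes> r)) \<otimes> (p \<otimes> p \<ominus> N) \<ominus> (B \<otimes> (r \<otimes> r \<ominus> (A \<otimes> N) \<otimes> (s \<otimes> s))) \<otimes> (p \<otimes> p)"
      unfolding gg bq by simp
    also have "\<dots> = (B \<otimes> N) \<otimes> (\<ominus> (r \<otimes> r \<ominus> A \<otimes> ((p \<otimes> s) \<otimes> (p \<otimes> s))))"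
      using L AB N by algebra
    also have "\<dots> = (B \<otimes> N) \<otimes> (\<zeta> \<otimes> \<zeta>)"
      unfolding zz e_def ..
    also have "\<dots> = ((\<beta> \<otimes> \<nu>) \<otimes> \<zeta>) \<otimes> ((\<beta> \<otimes> \<nu>) \<otimes> \<zeta>)"
      unfolding B_def N_def using L zL by algebra
    finally show ?thesis ..
  qed
  have nz1: "\<alpha> \<otimes> \<zeta> \<noteq> \<zero>"
    using integral_iff[of \<alpha> \<zeta>] L zL z0 has_signD(3)[OF a] by simp
  have nz2: "(\<beta> \<otimes> \<nu>) \<otimes> \<zeta> \<noteq> \<zero>"
    using integral_iff[of "\<beta> \<otimes> \<nu>" \<zeta>] L zL z0 has_signD(3)[OF bn] by simp
  have K1: "A \<otimes> (p \<otimes> s) \<in> K" and K2: "q \<otimes> (B \<otimes> r) \<in> K"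
    using AB pq rs K_closed(4) by auto

  have z_neg: "ev w \<zeta> = \<ominus> \<zeta>" if "w \<in> letters5" "x \<in> M" "x \<noteq> \<zero>" "ev w x = \<ominus> x" "ev w (x \<otimes> \<zeta>) = x \<otimes> \<zeta>" for w x
  proof -
    have ezL: "ev w \<zeta> \<in> carrier L"
      using ev_props(1)[OF that(1) zM] M_carrier by blast
    have xL: "x \<in> carrier L"
      using that(2) M_carrier by blast
    have "x \<otimes> (\<ominus> ev w \<zeta>) = x \<otimes> \<zeta>"
      using that ev_props(3)[OF that(1,2) zM] xL ezL by (simp add: l_minus r_minus)
    hence "\<ominus> ev w \<zeta> = \<zeta>"
      using m_lcancel[OF that(3) xL] ezL zL by simp
    thus ?thesis
      using minus_minus[OF ezL] by simp
  qed
  have z_pos: "ev w \<zeta> = \<zeta>" if "w \<in> letters5" "x \<in> M" "x \<noteq> \<zero>" "ev w x = x" "ev w (x \<otimes> \<zeta>) = x \<otimes> \<zeta>" for w x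
  proof -
    have ezL: "ev w \<zeta> \<in> carrier L"
      using ev_props(1)[OF that(1) zM] M_carrier by blast
    have xL: "x \<in> carrier L"
      using that(2) M_carrier by blast
    have "x \<otimes> ev w \<zeta> = x \<otimes> \<zeta>"
      using that ev_props(3)[OF that(1,2) zM] by simp
    thus ?thesis
      using m_lcancel[OF that(3) xL] ezL zL by simp
  qed
  have fix1: "ev w (\<alpha> \<otimes> \<zeta>) = \<alpha> \<otimes> \<zeta>" if "w \<in> letters5" "wrel (w @ w) []" "ev w \<alpha> = \<ominus> \<alpha>" for w
    by (rule norm_fixed_by_involution[OF K1 rs(1) has_signD(1)[OF a] has_sign_square[OF a] azM nz1 norm1 that])
  have fix2: "ev w ((\<beta> \<otimes> \<nu>) \<otimes> \<zeta>) = (\<beta> \<otimes> \<nu>) \<otimes> \<zeta>" if "w \<in> letters5" "wrel (w @ w) []" "ev w \<gamma> = \<ominus> \<gamma>" for w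
    by (rule norm_fixed_by_involution[OF K2 pq(1) has_signD(1)[OF g] has_sign_square[OF g] bzM nz2 norm2 that])
  have inv: "wrel ([i] @ [i]) []" if "i < 5" for i
    using wrel.invol[OF that] by simp
  \<comment> \<open>Letters 1, 3 and 4 negate \<alpha>, so they fix \<alpha>\<zeta> and therefore
    negate \<zeta>.\<close>
  have z_1: "ev [1] \<zeta> = \<ominus> \<zeta>" and z_3: "ev [3] \<zeta> = \<ominus> \<zeta>" and z_4: "ev [4] \<zeta> = \<ominus> \<zeta>"
    using z_neg[OF letter has_signD(1,3)[OF a] has_signD(4)[OF a] fix1[OF letter inv has_signD(4)[OF a]]]
    by auto
  \<comment> \<open>Letters 0 and 2 negate \<gamma>, hence fix \<beta>\<nu>\<zeta>. As 0 negates
    \<beta>\<nu> and 2 fixes it, they act on \<zeta> with opposite signs.\<close>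
  have z_0: "ev [0] \<zeta> = \<ominus> \<zeta>"
    using z_neg[OF letter has_signD(1,3)[OF bn] has_signD(4)[OF bn] fix2[OF letter inv has_signD(4)[OF g]], of 0]
    by simp
  have z_2: "ev [2] \<zeta> = \<zeta>"
    using z_pos[OF letter has_signD(1,3)[OF bn] has_signD(5)[OF bn] fix2[OF letter inv has_signD(4)[OF g]], of 2]
    by simp
  let ?w = "[0, 1, 2, 3, 4] :: nat list"
  have ev5: "ev ?w x = ev [0] (ev [1] (ev [2] (ev [3] (ev [4] x))))" if x: "x \<in> M" for x
  proof -
    have "ev (i # v) x = ev [i] (ev v x)" if "i < 5" "v \<in> letters5" for i v
      using ev_append[of "[i]" v x] that x by simp
    thus ?thesis
      by simp
  qed
  have ev_neg: "ev [i] (\<ominus> x) = \<ominus> ev [i] x" if "i < 5" "x \<in> M" for i x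
    using ev_props(6)[OF letter] that by blast
  \<comment> \<open>The sixth involution negates \<alpha> through three sign changes, so
    \<open>fix1\<close> makes it negate \<zeta>. The four sign changes of \<zeta> under 0, 1, 3, 4
    say that it fixes \<zeta>.\<close>
  have "ev ?w \<alpha> = \<ominus> \<alpha>"
    using ev5[OF has_signD(1)[OF a]] has_signD(4,5)[OF a] ev_neg has_signD(1)[OF a] M_closed(3) L(5) by simp
  hence "ev ?w \<zeta> = \<ominus> \<zeta>"
    using z_neg[OF _ has_signD(1,3)[OF a], of ?w] fix1[of ?w] wrel.prod by simp
  moreover have "ev ?w \<zeta> = \<zeta>"
    using ev5[OF zM] z_0 z_1 z_2 z_3 z_4 ev_neg zM M_closed(3) zL by simp
  ultimately show False
    using double_eq_zero[OF zL] z0 by simp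
qed

end

section \<open>Conclusion\<close>

text \<open>A word acts as the automorphism that \<phi> assigns to its class. Elements of
  \<open>Bij\<close> are extensional, so equal action on \<open>F3 L K\<close> means equality in the
  W-group, which injectivity of \<phi> turns into \<open>wrel\<close>.\<close>

lemma (in algebraic_closure) w5_extension_of_iso:
  assumes "char_zero_ring (L\<lparr>carrier := K\<rparr>)" and \<phi>: "\<phi> \<in> iso W5 (W_group L K)"
  shows "w5_extension L K (F3 L K) (\<lambda>w. \<phi> (wclass w))"
proof -
  let ?M = "F3 L K" and ?ev = "\<lambda>w. \<phi> (wclass w)"
  let ?G = "W_group L K"
  have carrier: "carrier ?G = {\<sigma> \<in> Bij ?M. \<sigma> \<in> ring_hom (L\<lparr>carrier := ?M\<rparr>) (L\<lparr>carrier := ?M\<rparr>) \<and> (\<forall>x\<in>K. \<sigma> x = x)}"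
    unfolding W_group_def galois_group_def by simp
  have mult: "(\<sigma> \<otimes>\<^bsub>?G\<^esub> \<tau>) x = \<sigma> (\<tau> x)" if "\<sigma> \<in> carrier ?G" "\<tau> \<in> carrier ?G" "x \<in> ?M" for \<sigma> \<tau> x
    using that unfolding carrier by (simp add: W_group_def galois_group_def BijGroup_def compose_def)
  have hom: "\<phi> \<in> hom W5 ?G" and bij: "bij_betw \<phi> (carrier W5) (carrier ?G)"
    using \<phi> unfolding iso_def by auto
  have ev: "?ev w \<in> carrier ?G" if "w \<in> letters5" for w
    using bij that by (auto dest: bij_betwE)
  have ev_append: "?ev (u @ v) x = ?ev u (?ev v x)" if "u \<in> letters5" "v \<in> letters5" "x \<in> ?M" for u v x
  proof -
    have "?ev (u @ v) = ?ev u \<otimes>\<^bsub>?G\<^esub> ?ev v"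
      using hom_mult[OF hom, of "wclass u" "wclass v"] that W5_mult[of u v] by simp
    thus ?thesis
      using mult ev that by simp
  qed
  have bijM: "bij_betw (?ev w) ?M ?M" "?ev w \<in> extensional ?M" if "w \<in> letters5" for w
    using ev[OF that] unfolding carrier Bij_def by auto
  have F2K: "K \<subseteq> ?M"
    using F3_props(2) F2_props(2) by blast
  show ?thesis
  proof (rule w5_extension.intro[OF algebraic_closure_axioms], rule w5_extension_axioms.intro)
    show "subfield ?M L" "K \<subseteq> ?M"
      using F3_props(1) F2K by auto
    show "?ev w \<in> ring_hom (L\<lparr>carrier := ?M\<rparr>) (L\<lparr>carrier := ?M\<rparr>)" if "w \<in> letters5" for w
      using ev[OF that] unfolding carrier by blast
    show "?ev w k = k" if "w \<in> letters5" "k \<in> K" for w k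
      using ev[OF that(1)] that(2) unfolding carrier by blast
    show "?ev (u @ v) x = ?ev u (?ev v x)" if "u \<in> letters5" "v \<in> letters5" "x \<in> ?M" for u v x
      using ev_append that .
    \<comment> \<open>The empty word acts idempotently and injectively, hence as the
      identity.\<close>
    show "?ev [] x = x" if x: "x \<in> ?M" for x
    proof -
      have "?ev [] x \<in> ?M"
        using bijM(1)[of "[]"] x bij_betwE by fastforce
      moreover have "?ev [] (?ev [] x) = ?ev [] x"
        using ev_append[of "[]" "[]" x] x by simp
      ultimately show ?thesis
        using bijM(1)[of "[]"] x by (simp add: bij_betw_def inj_on_def)
    qed
    show "(\<forall>x\<in>?M. ?ev u x = ?ev v x) \<longleftrightarrow> wrel u v" if "u \<in> letters5" "v \<in> letters5" for u v
    proof -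
      have "(\<forall>x\<in>?M. ?ev u x = ?ev v x) \<longleftrightarrow> ?ev u = ?ev v"
        using extensionalityI[OF bijM(2)[OF that(1)] bijM(2)[OF that(2)]] by auto
      also have "\<dots> \<longleftrightarrow> wclass u = wclass v"
        using bij that by (auto simp: bij_betw_def inj_on_def)
      finally show ?thesis
        using wclass_eq_iff[OF that] by simp
    qed
    show "x \<in> K" if "x \<in> ?M" "\<And>w. w \<in> letters5 \<Longrightarrow> ?ev w x = x" for x
    proof (rule W_group_fixed[OF assms(1) that(1)])
      fix \<sigma> assume "\<sigma> \<in> carrier ?G"
      then obtain w where "w \<in> letters5" "\<sigma> = ?ev w"
        using bij_betw_imp_surj_on[OF bij] by auto
      thus "\<sigma> x = x"
        using that(2) by blast
    qed
    show "x \<in> ?M" if "x \<in> carrier L" "x \<otimes> x \<in> K" for x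
      using F2_props(3)[OF that] F3_props(2) by blast
    show "\<omega> \<in> ?M" if "x \<in> K" "y \<in> K" "\<alpha> \<in> carrier L" "\<alpha> \<otimes> \<alpha> \<in> K" "\<beta> \<in> carrier L" "\<beta> \<noteq> \<zero>"
        "\<beta> \<otimes> \<beta> = x \<otimes> x \<ominus> (\<alpha> \<otimes> \<alpha>) \<otimes> (y \<otimes> y)" "\<omega> \<in> carrier L" "\<omega> \<otimes> \<omega> = x \<oplus> y \<otimes> \<alpha>" for x y \<alpha> \<beta> \<omega>
      using square_root_norm_in_F3[OF that] .
    show "\<one> \<oplus> \<one> \<noteq> \<zero>"
      using assms(1)[unfolded char_zero_ring_def, rule_format, of 2]
      by (simp add: add_pow_def nat_pow_def numeral_2_eq_2)
  qed
qed

theorem theorem3p3: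
  fixes L :: "('a, 'b) ring_scheme" and K :: "'a set"
  assumes "algebraic_closure L K"
    and "char_zero_ring (L\<lparr>carrier := K\<rparr>)"
    and "pythagorean (L\<lparr>carrier := K\<rparr>)"
    and "formally_real (L\<lparr>carrier := K\<rparr>)"
  shows "\<not> (\<exists>\<phi>. \<phi> \<in> iso W5 (W_group L K) \<and>
             indep_mod (W_group L K) (frattini (W_group L K)) (map \<phi> W5_gens))"
  using w5_extension.impossible[OF algebraic_closure.w5_extension_of_iso[OF assms(1,2)]] by blast

end
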